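(* Let $g,h:S^2\to S^2$ be marked (post-critically finite) quadratic branched covers. Then there exist a finite set $M\subset S^2$ containing the post-critical set $P_g$ of $g$ and the post-critical set $P_h$ of $h$, and a mapping class $\phi\in\mathrm{Mod}(S^2,M)$ (with a representing homeomorphism, also denoted $\phi$), such that $g\circ\phi$ is pure Hurwitz equivalent to $h$.
   Context: Branched covers $S^2\to S^2$ are orientation preserving; "quadratic" means of degree $2$. For a branched cover $f:S^2\to S^2$, the critical set $C_f$ is the set of points at which $f$ is not locally injective, and the post-critical set is $P_f=\bigcup_{n\ge 1}f^n(C_f)$. The map $f$ is post-critically finite if $P_f$ is finite. A marked branched cover is a branched cover $f$ together with a finite set $M_f\subset S^2$ such that $f(M_f)\subset M_f$ and $C_f\cup P_f\subset M_f$ (so $f$ is post-critically finite). For a finite set $M\subset S^2$, $\mathrm{Mod}(S^2,M)$ is the group of orientation-preserving homeomorphisms $\phi$ of $S^2$ with $\phi(M)=M$ (setwise; the points of $M$ may be permuted), modulo isotopy relative to $M$. The composition $g\circ\phi$ is formed with a homeomorphism representing the mapping class. Pure Hurwitz equivalence: two post-critically finite branched covers $f_1,f_2:S^2\to S^2$ are pure Hurwitz equivalent if there exist orientation-preserving homeomorphisms $\psi_1,\psi_2:S^2\to S^2$ such that (1) $\psi_1\circ f_1=f_2\circ\psi_2$; (2) $\psi_i(C_{f_1}\cup P_{f_1})=C_{f_2}\cup P_{f_2}$ for $i\in\{1,2\}$; (3) $\psi_1(p)=\psi_2(p)$ for all $p\in P_{f_1}$. *)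

theory Defs
  imports "HOL-Homology.Homology"
begin

text \<open>
  The sphere \<open>S\<^sup>2\<close> is the abstract topological space \<^term>\<open>nsphere 2\<close>, for which the library
  provides the homological mapping degree \<^term>\<open>Brouwer_degree2 2\<close>. Self-maps of the sphere are
  total functions on the ambient type; only their values on \<^term>\<open>topspace (nsphere 2)\<close> matter.
\<close>

abbreviation S2 :: "(nat \<Rightarrow> real) topology"
  where "S2 \<equiv> nsphere 2"

text \<open>
  A homeomorphism has mapping degree 1 or -1, and a branched cover with \<open>d\<close> sheets has mapping
  degree \<open>d\<close> or \<open>-d\<close>; in both cases the positive sign characterises preservation of orientation.
\<close>

definition orientation_preserving :: "((nat \<Rightarrow> real) \<Rightarrow> nat \<Rightarrow> real) \<Rightarrow> bool"
  where "orientation_preserving f \<longleftrightarrow> Brouwer_degree2 2 f > 0"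

definition orientation_preserving_homeo :: "((nat \<Rightarrow> real) \<Rightarrow> nat \<Rightarrow> real) \<Rightarrow> bool"
  where "orientation_preserving_homeo \<psi> \<longleftrightarrow>
    homeomorphic_map S2 S2 \<psi> \<and> orientation_preserving \<psi>"

text \<open>In suitable charts centred at \<open>x\<close> and \<open>f x\<close>, the map \<open>f\<close> is \<open>z \<mapsto> z ^ k\<close> on the unit disc.\<close>

definition locally_power_map_at ::
    "((nat \<Rightarrow> real) \<Rightarrow> nat \<Rightarrow> real) \<Rightarrow> (nat \<Rightarrow> real) \<Rightarrow> bool"
  where "locally_power_map_at f x \<longleftrightarrow>
    (\<exists>U V (u :: (nat \<Rightarrow> real) \<Rightarrow> complex) (v :: (nat \<Rightarrow> real) \<Rightarrow> complex) k::nat.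
       openin S2 U \<and> x \<in> U \<and> openin S2 V \<and> f ` U \<subseteq> V \<and> k \<ge> 1 \<and>
       homeomorphic_map (subtopology S2 U) (top_of_set (ball 0 1)) u \<and> u x = 0 \<and>
       homeomorphic_map (subtopology S2 V) (top_of_set (ball 0 1)) v \<and> v (f x) = 0 \<and>
       (\<forall>p\<in>U. v (f p) = u p ^ k))"

definition branched_cover :: "((nat \<Rightarrow> real) \<Rightarrow> nat \<Rightarrow> real) \<Rightarrow> bool"
  where "branched_cover f \<longleftrightarrow>
    continuous_map S2 S2 f \<and> (\<forall>x\<in>topspace S2. locally_power_map_at f x) \<and>
    orientation_preserving f"

definition critical_set :: "((nat \<Rightarrow> real) \<Rightarrow> nat \<Rightarrow> real) \<Rightarrow> (nat \<Rightarrow> real) set"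
  where "critical_set f = {x \<in> topspace S2. \<not> (\<exists>U. openin S2 U \<and> x \<in> U \<and> inj_on f U)}"

definition postcritical_set :: "((nat \<Rightarrow> real) \<Rightarrow> nat \<Rightarrow> real) \<Rightarrow> (nat \<Rightarrow> real) set"
  where "postcritical_set f = (\<Union>n\<in>{1..}. (f ^^ n) ` critical_set f)"

definition postcritically_finite :: "((nat \<Rightarrow> real) \<Rightarrow> nat \<Rightarrow> real) \<Rightarrow> bool"
  where "postcritically_finite f \<longleftrightarrow> finite (postcritical_set f)"

text \<open>
  The degree of a branched cover is its number of sheets, that is, the number of preimages of each
  point which is not a critical value. By compactness a branched cover has only finitely many
  critical values, so such points exist.
\<close>

definition has_degree :: "((nat \<Rightarrow> real) \<Rightarrow> nat \<Rightarrow> real) \<Rightarrow> nat \<Rightarrow> bool"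
  where "has_degree f d \<longleftrightarrow>
    (\<forall>y \<in> topspace S2 - f ` critical_set f. card {x \<in> topspace S2. f x = y} = d)"

definition quadratic :: "((nat \<Rightarrow> real) \<Rightarrow> nat \<Rightarrow> real) \<Rightarrow> bool"
  where "quadratic f \<longleftrightarrow> has_degree f 2"

definition marked_branched_cover ::
    "((nat \<Rightarrow> real) \<Rightarrow> nat \<Rightarrow> real) \<Rightarrow> (nat \<Rightarrow> real) set \<Rightarrow> bool"
  where "marked_branched_cover f M \<longleftrightarrow>
    branched_cover f \<and> finite M \<and> M \<subseteq> topspace S2 \<and> f ` M \<subseteq> M \<and>
    critical_set f \<union> postcritical_set f \<subseteq> M"

definition marked_homeos ::
    "(nat \<Rightarrow> real) set \<Rightarrow> ((nat \<Rightarrow> real) \<Rightarrow> nat \<Rightarrow> real) set"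
  where "marked_homeos M = {\<phi>. orientation_preserving_homeo \<phi> \<and> \<phi> ` M = M}"

text \<open>Isotopy through homeomorphisms, constant on each point of \<open>M\<close>.\<close>

definition isotopic_rel ::
    "(nat \<Rightarrow> real) set \<Rightarrow> ((nat \<Rightarrow> real) \<Rightarrow> nat \<Rightarrow> real) \<Rightarrow> ((nat \<Rightarrow> real) \<Rightarrow> nat \<Rightarrow> real) \<Rightarrow> bool"
  where "isotopic_rel M \<phi> \<psi> \<longleftrightarrow>
    homotopic_with (\<lambda>\<eta>. homeomorphic_map S2 S2 \<eta> \<and> (\<forall>m\<in>M. \<eta> m = \<phi> m)) S2 S2 \<phi> \<psi>"

definition isotopy_relation ::
    "(nat \<Rightarrow> real) set \<Rightarrow>
      (((nat \<Rightarrow> real) \<Rightarrow> nat \<Rightarrow> real) \<times> ((nat \<Rightarrow> real) \<Rightarrow> nat \<Rightarrow> real)) set"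
  where "isotopy_relation M =
    {(\<phi>, \<psi>). \<phi> \<in> marked_homeos M \<and> \<psi> \<in> marked_homeos M \<and> isotopic_rel M \<phi> \<psi>}"

lemma isotopic_rel_agree: "isotopic_rel M \<phi> \<psi> \<Longrightarrow> m \<in> M \<Longrightarrow> \<psi> m = \<phi> m"
  unfolding isotopic_rel_def by (drule homotopic_with_imp_property) auto

lemma isotopic_rel_rebase:
  assumes "isotopic_rel M \<phi> \<psi>"
  shows "isotopic_rel M \<psi> \<eta> \<longleftrightarrow>
    homotopic_with (\<lambda>\<theta>. homeomorphic_map S2 S2 \<theta> \<and> (\<forall>m\<in>M. \<theta> m = \<phi> m)) S2 S2 \<psi> \<eta>"
proof -
  have "\<forall>m\<in>M. \<psi> m = \<phi> m"
    using isotopic_rel_agree[OF assms] by blast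
  then have "(\<lambda>\<theta>. homeomorphic_map S2 S2 \<theta> \<and> (\<forall>m\<in>M. \<theta> m = \<psi> m)) =
        (\<lambda>\<theta>. homeomorphic_map S2 S2 \<theta> \<and> (\<forall>m\<in>M. \<theta> m = \<phi> m))"
    by (intro ext conj_cong refl ball_cong) simp
  then show ?thesis by (simp only: isotopic_rel_def)
qed

lemma isotopic_rel_refl: "homeomorphic_map S2 S2 \<phi> \<Longrightarrow> isotopic_rel M \<phi> \<phi>"
  unfolding isotopic_rel_def homotopic_with_refl
  by (intro conjI ballI refl homeomorphic_imp_continuous_map)

lemma isotopic_rel_sym: "isotopic_rel M \<phi> \<psi> \<Longrightarrow> isotopic_rel M \<psi> \<phi>"
  by (subst isotopic_rel_rebase, assumption) (unfold isotopic_rel_def, rule homotopic_with_symD)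

lemma isotopic_rel_trans:
  assumes "isotopic_rel M \<phi> \<psi>" and "isotopic_rel M \<psi> \<eta>"
  shows "isotopic_rel M \<phi> \<eta>"
  using homotopic_with_trans[OF assms(1)[unfolded isotopic_rel_def]
      assms(2)[unfolded isotopic_rel_rebase[OF assms(1)]]]
  by (simp only: isotopic_rel_def)

lemma equiv_isotopy_relation: "equiv (marked_homeos M) (isotopy_relation M)"
proof (rule equivI)
  show "isotopy_relation M \<subseteq> marked_homeos M \<times> marked_homeos M"
    unfolding isotopy_relation_def by blast
  show "refl_on (marked_homeos M) (isotopy_relation M)"
    unfolding refl_on_def isotopy_relation_def marked_homeos_def orientation_preserving_homeo_def
    using isotopic_rel_refl by blast
  show "sym (isotopy_relation M)"
    unfolding sym_def isotopy_relation_def using isotopic_rel_sym by blast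
  show "trans (isotopy_relation M)"
    unfolding trans_def isotopy_relation_def using isotopic_rel_trans by blast
qed

text \<open>The elements of \<open>Mod(S\<^sup>2, M)\<close>, as sets of representing homeomorphisms.\<close>

definition Mod_S2 ::
    "(nat \<Rightarrow> real) set \<Rightarrow> ((nat \<Rightarrow> real) \<Rightarrow> nat \<Rightarrow> real) set set"
  where "Mod_S2 M = marked_homeos M // isotopy_relation M"

definition pure_Hurwitz_equivalent ::
    "((nat \<Rightarrow> real) \<Rightarrow> nat \<Rightarrow> real) \<Rightarrow> ((nat \<Rightarrow> real) \<Rightarrow> nat \<Rightarrow> real) \<Rightarrow> bool"
  where "pure_Hurwitz_equivalent f1 f2 \<longleftrightarrow>
    branched_cover f1 \<and> postcritically_finite f1 \<and>
    branched_cover f2 \<and> postcritically_finite f2 \<and>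
    (\<exists>\<psi>1 \<psi>2. orientation_preserving_homeo \<psi>1 \<and> orientation_preserving_homeo \<psi>2 \<and>
      (\<forall>x\<in>topspace S2. \<psi>1 (f1 x) = f2 (\<psi>2 x)) \<and>
      \<psi>1 ` (critical_set f1 \<union> postcritical_set f1) = critical_set f2 \<union> postcritical_set f2 \<and>
      \<psi>2 ` (critical_set f1 \<union> postcritical_set f1) = critical_set f2 \<union> postcritical_set f2 \<and>
      (\<forall>p\<in>postcritical_set f1. \<psi>1 p = \<psi>2 p))"

end

theory Submission
  imports Defs "HOL-Analysis.Analysis"
begin

text \<open>
  A map of degree 2 that is locally a power map has exactly two critical points, each alone in its
  fibre. In planar charts sending one critical point and its value to infinity, the other pair to 0,
  it becomes the square of a homeomorphism of the plane: a continuous square root exists away from 0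
  because the monodromy of \<open>z \<mapsto> z\<^sup>2\<close> around the critical point is trivial on square roots. Hence two
  such maps \<open>f\<close> and \<open>h\<close> with the same critical values satisfy \<open>h \<circ> \<beta> = f\<close> for some homeomorphism \<open>\<beta>\<close>.

  Choose finite sets \<open>A\<close> and \<open>B\<close> containing the critical values of \<open>g\<close> and \<open>h\<close>, let \<open>M = g\<^sup>-\<^sup>1(A)\<close> and
  \<open>W = h\<^sup>-\<^sup>1(B)\<close>, and take an orientation preserving homeomorphism \<open>\<alpha>\<close> with \<open>\<alpha>(A) = B\<close> and \<open>\<alpha>(M) = W\<close>
  that carries critical values to critical values. With \<open>h \<circ> \<beta> = \<alpha> \<circ> g\<close> we get \<open>\<beta>(M) = W = \<alpha>(M)\<close>, so
  \<open>\<phi> = \<beta>\<^sup>-\<^sup>1 \<circ> \<alpha>\<close> preserves \<open>M\<close>, and \<open>\<alpha>\<close> conjugates \<open>g \<circ> \<phi>\<close> to \<open>h\<close>. By Riemann-Hurwitz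
  \<open>|M| = 2|A| - 2\<close>, so such an \<open>\<alpha>\<close> exists once \<open>|A \<inter> M| = |B \<inter> W|\<close> and \<open>|A - M| = |B - W|\<close>; each of these
  numbers can be raised by one without changing the other by adding a suitable point to \<open>A\<close> or \<open>B\<close>.
\<close>

section \<open>Square roots and double covers of the plane\<close>

text \<open>The quotient \<open>a / b\<close> is continuous with values in {1, -1}, hence constant
  on a connected set. The monodromy signs below are obtained this way.\<close>

lemma square_roots_agree_up_to_sign:
  fixes a b :: "'a::topological_space \<Rightarrow> complex"
  assumes D: "connected D" and a: "continuous_on D a" and b: "continuous_on D b"
    and eq: "\<And>x. x \<in> D \<Longrightarrow> (a x)\<^sup>2 = (b x)\<^sup>2" and nz: "\<And>x. x \<in> D \<Longrightarrow> b x \<noteq> 0"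
  shows "(\<forall>x\<in>D. a x = b x) \<or> (\<forall>x\<in>D. a x = - b x)"
proof -
  have val: "a x / b x = 1 \<or> a x / b x = -1" if "x \<in> D" for x
    using eq[OF that] nz[OF that] by (auto simp: power2_eq_iff)
  have "(\<lambda>x. a x / b x) constant_on D"
  proof (rule continuous_finite_range_constant[OF D])
    show "continuous_on D (\<lambda>x. a x / b x)"
      using nz by (intro continuous_intros a b) auto
    have "(\<lambda>x. a x / b x) ` D \<subseteq> {1, -1}" using val by blast
    then show "finite ((\<lambda>x. a x / b x) ` D)" by (rule finite_subset) simp
  qed
  then obtain c where c: "\<And>x. x \<in> D \<Longrightarrow> a x / b x = c"
    unfolding constant_on_def by blast
  have ab: "a x = c * b x" if "x \<in> D" for x
    using c[OF that] nz[OF that] by (simp add: field_simps)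
  show ?thesis
  proof (cases "D = {}")
    case False
    then have "c = 1 \<or> c = -1" using val c by blast
    then show ?thesis using ab by auto
  qed simp
qed

lemma exp_shift_2pi: "exp (z + 2 * of_real pi * \<i>) = exp z"
  by (simp add: exp_add)

text \<open>Invariance under the deck translation makes \<open>S\<close> constant on the fibres of
  \<open>exp\<close>. Its composite with \<open>Ln\<close> is then continuous even across the branch
  cut, because every other branch of the logarithm gives the same value.\<close>

lemma periodic_descends_along_exp:
  fixes S :: "complex \<Rightarrow> complex"
  assumes D: "open D" "0 \<notin> D" and S: "continuous_on (exp -` D) S"
    and per: "\<And>z. exp z \<in> D \<Longrightarrow> S (z + 2 * of_real pi * \<i>) = S z"
  shows "continuous_on D (S \<circ> Ln)" and "\<And>z. exp z \<in> D \<Longrightarrow> S (Ln (exp z)) = S z"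
proof -
  have pern: "exp (z + 2 * of_nat n * of_real pi * \<i>) = exp z \<and> S (z + 2 * of_nat n * of_real pi * \<i>) = S z"
    if "exp z \<in> D" for z and n :: nat
  proof (induction n)
    case (Suc n)
    have eq: "z + 2 * of_nat (Suc n) * of_real pi * \<i> = (z + 2 * of_nat n * of_real pi * \<i>) + 2 * of_real pi * \<i>"
      by (simp add: algebra_simps)
    show ?case unfolding eq exp_shift_2pi using Suc per that by simp
  qed simp
  have same: "S u = S z" if e: "exp u = exp z" and "exp z \<in> D" for u z
  proof -
    obtain n :: int where n: "u = z + (of_int (2 * n) * pi) * \<i>" using e[unfolded exp_eq] ..
    show ?thesis
    proof (cases "n \<ge> 0")
      case True
      then have "u = z + 2 * of_nat (nat n) * of_real pi * \<i>" using n by (simp add: algebra_simps)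
      then show ?thesis using pern that by simp
    next
      case False
      then have "z = u + 2 * of_nat (nat (- n)) * of_real pi * \<i>" using n by (simp add: algebra_simps)
      then show ?thesis using pern[of u "nat (- n)"] that by simp
    qed
  qed
  show 1: "S (Ln (exp z)) = S z" if "exp z \<in> D" for z
    using that by (intro same) simp_all
  have "isCont (S \<circ> Ln) z0" if "z0 \<in> D" for z0
  proof -
    have z0: "z0 \<noteq> 0" using that D by blast
    \<comment> \<open>A branch of the logarithm that is continuous near \<open>z0\<close>, even on
      the cut of \<open>Ln\<close>, since \<open>z / z0\<close> is close to 1 there.\<close>
    define l where "l = (\<lambda>z. Ln (z / z0) + Ln z0)"
    have op: "open (exp -` D)" using D(1) by (intro open_vimage continuous_intros)
    have "l z0 = Ln z0" using z0 by (simp add: l_def)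
    then have "isCont S (l z0)"
      using S op that z0 by (simp add: continuous_on_eq_continuous_at)
    moreover have "isCont l z0"
      unfolding l_def using z0 by (intro continuous_intros) auto
    ultimately have c: "isCont (\<lambda>z. S (l z)) z0" by (simp add: isCont_o2)
    have "eventually (\<lambda>z. (S \<circ> Ln) z = S (l z)) (nhds z0)"
    proof (rule eventually_nhds[THEN iffD2], intro exI conjI ballI)
      show "open D" "z0 \<in> D" by fact+
      fix z assume z: "z \<in> D"
      then have "z \<noteq> 0" using D by blast
      then have "exp (l z) = z" using z0 by (simp add: l_def exp_add)
      moreover have "exp (Ln z) = z" using \<open>z \<noteq> 0\<close> by simp
      ultimately show "(S \<circ> Ln) z = S (l z)" using z by (simp, intro same) auto
    qed
    from isCont_cong[OF this] c show ?thesis by (simp only:)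
  qed
  then show "continuous_on D (S \<circ> Ln)" by (blast intro: continuous_at_imp_continuous_on)
qed

text \<open>
  With \<open>T\<^sup>2 = k \<circ> exp\<close> on the left half-plane, \<open>T (z + 2 \<pi> \<i>) = \<plusminus> T z\<close> with a constant sign, so
  \<open>z \<mapsto> T (2 z)\<close> is \<open>2 \<pi> \<i>\<close>-periodic and descends along \<open>exp\<close>.
\<close>

lemma sqrt_of_square_substitution:
  fixes k :: "complex \<Rightarrow> complex"
  assumes k: "continuous_on (ball 0 1) k" and nz: "\<And>z. z \<in> ball 0 1 - {0} \<Longrightarrow> k z \<noteq> 0"
  obtains s where "continuous_on (ball 0 1 - {0}) s"
    "\<And>z. z \<in> ball 0 1 - {0} \<Longrightarrow> (s z)\<^sup>2 = k (z\<^sup>2)"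
proof -
  \<comment> \<open>The left half-plane is the full preimage of the punctured disc under
    \<open>exp\<close>; its convexity provides the square root \<open>T\<close>.\<close>
  define H where "H = {z :: complex. Re z < 0}"
  have H: "z \<in> H \<longleftrightarrow> exp z \<in> ball 0 1 - {0}" for z by (simp add: H_def)
  have convH: "convex H" unfolding H_def by (simp add: convex_halfspace_Re_lt)
  have "continuous_on H (\<lambda>z. k (exp z))"
    by (rule continuous_on_compose2[OF k]) (use H in \<open>auto intro!: continuous_intros\<close>)
  then obtain T where T: "continuous_on H T" "\<And>z. z \<in> H \<Longrightarrow> k (exp z) = (T z)\<^sup>2"
    using continuous_sqrt_on_contractible[of H "\<lambda>z. k (exp z)"] nz H convH
      convex_imp_contractible by blast
  have Tnz: "T z \<noteq> 0" if "z \<in> H" for z using T(2)[OF that] nz that H by auto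
  have sh: "z + 2 * of_real pi * \<i> \<in> H" if "z \<in> H" for z using that by (simp add: H_def)
  have contsh: "continuous_on H (\<lambda>z. T (z + 2 * of_real pi * \<i>))"
    by (rule continuous_on_compose2[OF T(1)]) (use sh in \<open>auto intro!: continuous_intros\<close>)
  have "(\<forall>z\<in>H. T (z + 2 * of_real pi * \<i>) = T z) \<or> (\<forall>z\<in>H. T (z + 2 * of_real pi * \<i>) = - T z)"
  proof (rule square_roots_agree_up_to_sign[OF convex_connected[OF convH] contsh T(1)])
    fix z assume z: "z \<in> H"
    show "(T (z + 2 * of_real pi * \<i>))\<^sup>2 = (T z)\<^sup>2"
      using T(2)[OF z] T(2)[OF sh[OF z]] by (simp only: exp_shift_2pi)
  qed (fact Tnz)
  then have per2: "T (z + 2 * of_real pi * \<i> + 2 * of_real pi * \<i>) = T z" if "z \<in> H" for z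
    using sh that by (metis minus_minus)
  have pre: "exp -` (ball 0 1 - {0}) = H" using H by blast
  have dbl: "2 * z \<in> H" if "z \<in> H" for z using that by (simp add: H_def)
  define S where "S = (\<lambda>z. T (2 * z))"
  have "continuous_on H S"
    unfolding S_def by (rule continuous_on_compose2[OF T(1)]) (use dbl in \<open>auto intro!: continuous_intros\<close>)
  then have Sc: "continuous_on (exp -` (ball 0 1 - {0})) S" by (simp only: pre)
  have Sp: "S (z + 2 * of_real pi * \<i>) = S z" if "exp z \<in> ball 0 1 - {0}" for z
    using per2[OF dbl] that H by (simp add: S_def algebra_simps)
  note d = periodic_descends_along_exp[OF _ _ Sc Sp]
  show ?thesis
  proof (rule that)
    show "continuous_on (ball 0 1 - {0}) (S \<circ> Ln)" by (rule d(1)) auto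
    fix z :: complex assume z: "z \<in> ball 0 1 - {0}"
    then have "exp (Ln z) = z" by simp
    then have "Ln z \<in> H" using H z by metis
    then have "(S (Ln z))\<^sup>2 = k (exp (2 * Ln z))" by (simp add: S_def T(2) dbl)
    also have "exp (2 * Ln z) = z\<^sup>2" using \<open>exp (Ln z) = z\<close> by (simp add: exp_double)
    finally show "((S \<circ> Ln) z)\<^sup>2 = k (z\<^sup>2)" by simp
  qed
qed

text \<open>Pulled back along \<open>exp\<close>, \<open>F\<close> has a global square root
  \<open>S\<close>, and translation by 2 pi i multiplies \<open>S\<close> by a constant sign. The
  given root \<open>s\<close> near 0 is single-valued, which forces the sign to be plus, so
  \<open>S\<close> descends to the punctured plane.\<close>

lemma continuous_sqrt_of_local_sqrt:
  fixes F :: "complex \<Rightarrow> complex"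
  assumes F: "continuous_on UNIV F" and F0: "\<And>z. F z = 0 \<longleftrightarrow> z = 0"
    and N: "open N" "0 \<in> N" and s: "continuous_on (N - {0}) s"
    and sF: "\<And>z. z \<in> N - {0} \<Longrightarrow> (s z)\<^sup>2 = F z"
  obtains G where "continuous_on UNIV G" "\<And>z. (G z)\<^sup>2 = F z"
proof -
  have "continuous_on UNIV (\<lambda>z. F (exp z))"
    by (rule continuous_on_compose2[OF F]) (auto intro!: continuous_intros)
  then obtain S where S: "continuous_on UNIV S" "\<And>z. F (exp z) = (S z)\<^sup>2"
    using continuous_sqrt_on_contractible[of UNIV "\<lambda>z. F (exp z)"] F0
      convex_imp_contractible[OF convex_UNIV] by (metis UNIV_I exp_not_eq_zero)
  have Snz: "S z \<noteq> 0" for z using S(2)[of z] F0[of "exp z"] by auto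
  have sgn: "(\<forall>z\<in>UNIV. S (z + 2 * of_real pi * \<i>) = S z) \<or> (\<forall>z\<in>UNIV. S (z + 2 * of_real pi * \<i>) = - S z)"
  proof (rule square_roots_agree_up_to_sign[OF connected_UNIV _ S(1)])
    show "continuous_on UNIV (\<lambda>z. S (z + 2 * of_real pi * \<i>))"
      by (rule continuous_on_compose2[OF S(1)]) (auto intro!: continuous_intros)
    show "(S (z + 2 * of_real pi * \<i>))\<^sup>2 = (S z)\<^sup>2" for z
      using S(2)[of z] S(2)[of "z + 2 * of_real pi * \<i>"] by (simp only: exp_shift_2pi)
  qed (simp add: Snz)
  obtain r where r: "r > 0" "ball 0 r \<subseteq> N" using N openE by blast
  \<comment> \<open>A half-plane far enough to the left that \<open>exp\<close> maps it into
    \<open>N - {0}\<close>.\<close>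
  define H where "H = {z :: complex. Re z < ln r}"
  have H: "exp z \<in> N - {0}" if "z \<in> H" for z
  proof -
    have "exp (Re z) < r" using that r(1) by (metis H_def exp_less_mono exp_ln mem_Collect_eq)
    then show ?thesis using r(2) by auto
  qed
  have "(\<forall>z\<in>H. s (exp z) = S z) \<or> (\<forall>z\<in>H. s (exp z) = - S z)"
  proof (rule square_roots_agree_up_to_sign)
    show "connected H" unfolding H_def by (intro convex_connected convex_halfspace_Re_lt)
    show "continuous_on H (\<lambda>z. s (exp z))"
      by (rule continuous_on_compose2[OF s]) (use H in \<open>auto intro!: continuous_intros\<close>)
    show "continuous_on H S" using S(1) continuous_on_subset by blast
    show "(s (exp z))\<^sup>2 = (S z)\<^sup>2" if "z \<in> H" for z using sF[OF H[OF that]] S(2) by simp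
  qed (simp add: Snz)
  \<comment> \<open>One point decides the sign: \<open>s \<circ> exp\<close> is periodic and agrees
    with \<open>S\<close> up to one sign on all of \<open>H\<close>, so \<open>S\<close> takes equal
    values at \<open>z0\<close> and its translate.\<close>
  moreover define z0 where "z0 = complex_of_real (ln r - 1)"
  have z0: "z0 \<in> H" "z0 + 2 * of_real pi * \<i> \<in> H" by (simp_all add: z0_def H_def)
  ultimately have eq0: "S (z0 + 2 * of_real pi * \<i>) = S z0"
    using exp_shift_2pi[of z0] by (metis neg_equal_iff_equal)
  have per: "S (z + 2 * of_real pi * \<i>) = S z" for z
  proof (rule disjE[OF sgn])
    assume "\<forall>z\<in>UNIV. S (z + 2 * of_real pi * \<i>) = - S z"
    then have "S z0 = - S z0" using eq0 by (metis UNIV_I)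
    then show ?thesis using Snz[of z0] by simp
  qed simp
  define G where "G = (\<lambda>z. if z = 0 then 0 else S (Ln z))"
  have GF: "(G z)\<^sup>2 = F z" for z
    using S(2)[of "Ln z"] F0[of z] by (cases "z = 0") (auto simp: G_def)
  have "continuous_on (- {0}) (S \<circ> Ln)"
    by (rule periodic_descends_along_exp(1)) (use S(1) continuous_on_subset per in auto)
  then have c1: "continuous_on (- {0}) G"
    by (rule continuous_on_eq) (simp add: G_def)
  have "isCont G z" for z
  proof (cases "z = 0")
    case False
    then show ?thesis using c1 continuous_on_eq_continuous_at[of "- {0}" G] by auto
  next
    case True
    \<comment> \<open>At 0 no logarithm is available; continuity there follows from
      \<open>norm (G z)\<close> being the square root of \<open>norm (F z)\<close>.\<close>
    have "((\<lambda>z. sqrt (norm (F z))) \<longlongrightarrow> sqrt (norm (F 0))) (at 0)"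
      using F by (intro tendsto_intros) (metis UNIV_I continuous_on_def)
    moreover have "sqrt (norm (F z)) = norm (G z)" for z
      by (simp add: GF[symmetric] norm_power)
    ultimately have "((\<lambda>z. norm (G z)) \<longlongrightarrow> 0) (at 0)" using F0 by (simp add: G_def)
    then have "(G \<longlongrightarrow> 0) (at 0)" by (rule tendsto_norm_zero_cancel)
    then show ?thesis using True by (simp add: isCont_def G_def)
  qed
  then have "continuous_on UNIV G" by (simp add: continuous_at_imp_continuous_on)
  then show ?thesis using GF that by blast
qed

text \<open>If the values \<open>G (z n)\<close> converge, the points \<open>z n\<close> stay in a
  disc because \<open>G\<close> tends to infinity. A convergent subsequence then yields a point
  mapped to the limit.\<close>

lemma closed_range_if_tends_to_infinity:
  fixes G :: "complex \<Rightarrow> complex"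
  assumes G: "continuous_on UNIV G" and inf: "filterlim G at_infinity at_infinity"
  shows "closed (range G)"
proof -
  have "l \<in> range G" if xs: "\<forall>n. x n \<in> range G" and l: "x \<longlonglongrightarrow> l" for x l
  proof -
    have "\<forall>n. \<exists>z. x n = G z" using xs by blast
    then obtain z where z: "\<And>n. x n = G (z n)" by metis
    have "bounded (range x)" using l by (rule convergent_imp_bounded)
    then obtain B where B: "\<And>n. norm (x n) \<le> B" by (auto simp: bounded_iff)
    have "0 \<le> B" using B[of 0] norm_ge_zero[of "x 0"] by linarith
    then have "eventually (\<lambda>z. B + 1 \<le> norm (G z)) at_infinity"
      using inf filterlim_at_infinity[of 0 G at_infinity] by auto
    then obtain R where R: "\<And>z. R \<le> norm z \<Longrightarrow> B + 1 \<le> norm (G z)"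
      unfolding eventually_at_infinity by blast
    have "norm (z n) \<le> R" for n
      using R[of "z n"] B[of n] z[of n] by force
    then have "\<And>n. z n \<in> cball 0 R" by simp
    then obtain w r where w: "strict_mono r" "(z \<circ> r) \<longlonglongrightarrow> w"
      using compact_cball[of "0 :: complex" R, unfolded compact_def, rule_format, of z] by auto
    have "(\<lambda>n. G ((z \<circ> r) n)) \<longlonglongrightarrow> G w"
      by (rule continuous_on_tendsto_compose[OF G w(2)]) auto
    moreover have "(\<lambda>n. G ((z \<circ> r) n)) \<longlonglongrightarrow> l"
      using LIMSEQ_subseq_LIMSEQ[OF l w(1)] z by (simp add: o_def)
    ultimately show ?thesis using LIMSEQ_unique by blast
  qed
  then show ?thesis unfolding closed_sequential_limits by blast
qed

text \<open>The square root \<open>G\<close> of \<open>F\<close> maps the punctured plane onto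
  itself, since its image there is open (by openness of \<open>F\<close>) and relatively closed (by
  properness). It is injective because a point \<open>z\<close> with \<open>G z = - G x\<close> lies
  in the \<open>F\<close>-fibre of \<open>x\<close>, and fibres have at most two points.\<close>

lemma plane_double_cover_is_square_of_homeo:
  fixes F :: "complex \<Rightarrow> complex"
  assumes F: "continuous_on UNIV F" and F0: "\<And>z. F z = 0 \<longleftrightarrow> z = 0"
    and N: "open N" "0 \<in> N" and s: "continuous_on (N - {0}) s"
    and sF: "\<And>z. z \<in> N - {0} \<Longrightarrow> (s z)\<^sup>2 = F z"
    and op: "\<And>U. open U \<Longrightarrow> open (F ` U)"
    and inf: "filterlim F at_infinity at_infinity"
    and fib: "\<And>x y z. F x = F y \<Longrightarrow> F y = F z \<Longrightarrow> x = y \<or> y = z \<or> x = z"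
  obtains G G' where "homeomorphism UNIV UNIV G G'" "\<And>z. (G z)\<^sup>2 = F z"
proof -
  obtain G where G: "continuous_on UNIV G" and GF: "\<And>z. (G z)\<^sup>2 = F z"
    using continuous_sqrt_of_local_sqrt[OF F F0 N s sF] by metis
  have G0: "G z = 0 \<longleftrightarrow> z = 0" for z using GF[of z] F0[of z] by auto
  have opG: "open (G ` (- {0}))"
  proof (subst open_subopen, rule ballI)
    fix w0 assume "w0 \<in> G ` (- {0})"
    then obtain z0 where z0: "z0 \<noteq> 0" "w0 = G z0" by blast
    then have w0: "w0 \<noteq> 0" using G0 by simp
    \<comment> \<open>This ball never contains both \<open>w\<close> and \<open>- w\<close>: their
      distances from \<open>w0\<close> add up to at least \<open>2 * norm w0\<close>.\<close>
    define B where "B = ball w0 (norm w0)"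
    define U where "U = G -` B"
    have U: "open U" "z0 \<in> U"
      unfolding U_def B_def using G w0 z0 by (auto intro: open_vimage)
    \<comment> \<open>A point of \<open>W\<close> has its square in the image of \<open>U\<close>
      under \<open>F\<close>, so it is \<open>G z\<close> or \<open>- G z\<close> for some
      \<open>z\<close> in \<open>U\<close>; the choice of \<open>B\<close> excludes the second
      case.\<close>
    define W where "W = B \<inter> (\<lambda>w. w\<^sup>2) -` (F ` U)"
    have "open W" unfolding W_def B_def
      by (intro open_Int open_ball open_vimage op U continuous_intros)
    moreover have "w0 \<in> W"
      using U z0 w0 GF[of z0] unfolding W_def B_def by auto
    moreover have "W \<subseteq> G ` (- {0})"
    proof
      fix w assume w: "w \<in> W"
      then obtain z where z: "z \<in> U" "w\<^sup>2 = F z" unfolding W_def by blast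
      have "w \<noteq> 0" using w by (auto simp: W_def B_def)
      have "w = G z \<or> w = - G z" using z(2) GF[of z] by (metis power2_eq_iff)
      moreover have "w \<noteq> - G z"
      proof
        assume "w = - G z"
        then have "norm (w0 - w) < norm w0" "norm (w0 + w) < norm w0"
          using w z(1) by (auto simp: W_def B_def U_def dist_norm)
        then have "norm ((w0 - w) + (w0 + w)) < norm w0 + norm w0"
          using norm_triangle_ineq[of "w0 - w" "w0 + w"] by linarith
        moreover have "norm ((w0 - w) + (w0 + w)) = norm w0 + norm w0"
          by (simp flip: mult_2 add: norm_mult)
        ultimately show False by simp
      qed
      ultimately have "w = G z" by blast
      with \<open>w \<noteq> 0\<close> G0 show "w \<in> G ` (- {0})" by auto
    qed
    ultimately show "\<exists>T. open T \<and> w0 \<in> T \<and> T \<subseteq> G ` (- {0})" by blast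
  qed
  have "filterlim (\<lambda>z. sqrt (norm (F z))) at_top at_infinity"
    using inf by (intro filterlim_compose[OF sqrt_at_top] filterlim_at_infinity_imp_norm_at_top)
  moreover have "sqrt (norm (F z)) = norm (G z)" for z
    by (simp add: GF[symmetric] norm_power)
  ultimately have "filterlim G at_infinity at_infinity"
    using filterlim_norm_at_top_imp_at_infinity by simp
  then have cl: "closed (range G)" by (rule closed_range_if_tends_to_infinity[OF G])
  have eq: "G ` (- {0}) = range G \<inter> - {0}" using G0 by auto
  have "G ` (- {0}) = - {0}"
  proof -
    have con: "connected (- {0 :: complex})" by (simp add: connected_punctured_universe)
    have "openin (top_of_set (- {0})) (G ` (- {0}))"
      using opG eq by (metis inf_le2 open_subset)
    moreover have "closedin (top_of_set (- {0})) (G ` (- {0}))"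
      using cl eq by (metis closedin_closed_Int inf_commute)
    moreover have "G ` (- {0}) \<noteq> {}" by (metis ComplI image_is_empty empty_iff singletonD zero_neq_one)
    ultimately show ?thesis using con by (meson connected_clopen)
  qed
  then have surj: "surj G"
    by (metis Compl_iff G0 imageE rangeI singletonI surj_def singletonD)
  have "inj G"
  proof (rule injI)
    fix x y assume xy: "G x = G y"
    obtain z where z: "G z = - G x" using surj by (metis surjE)
    have "F x = F y" "F y = F z" using GF[of x] GF[of y] GF[of z] z xy by simp_all
    with fib consider "x = y" | "y = z" | "x = z" by blast
    then show "x = y"
    proof cases
      case 2
      then have "G x = 0" using z xy by simp
      then show ?thesis using xy G0 by metis
    next
      case 3
      then have "G x = 0" using z by simp
      then show ?thesis using xy G0 by metis
    qed
  qed
  obtain G' where "homeomorphism UNIV (range G) G G'"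
    using invariance_of_domain_homeomorphism[OF open_UNIV G _ \<open>inj G\<close>] by auto
  then have hom: "homeomorphism UNIV UNIV G G'" using surj by simp
  then show ?thesis using hom GF that by blast
qed

lemma image_Int_vimage: "f ` (U \<inter> f -` T) = f ` U \<inter> T"
  by blast

text \<open>Such an \<open>F\<close> would be a two-sheeted covering of the simply connected plane
  by a connected set, which is impossible. This will exclude quadratic maps with fewer than two
  critical points.\<close>

lemma no_connected_double_cover_of_plane:
  fixes F :: "complex \<Rightarrow> complex"
  assumes D: "open D" "connected D" and F: "continuous_on D F"
    and loc: "\<And>z. z \<in> D \<Longrightarrow> \<exists>U. open U \<and> z \<in> U \<and> inj_on F (U \<inter> D)"
    and two: "\<And>w. card {z \<in> D. F z = w} = 2"
  shows False
proof -
  have nbhd: "\<exists>U1 U2. open U1 \<and> open U2 \<and> U1 \<subseteq> D \<and> U2 \<subseteq> D \<and> U1 \<inter> U2 = {} \<and> inj_on F U1 \<and> inj_on F U2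
      \<and> w \<in> F ` U1 \<and> w \<in> F ` U2" for w
  proof -
    obtain x y where xy: "x \<noteq> y" "{z \<in> D. F z = w} = {x, y}" using two card_2_iff by metis
    then have xyD: "x \<in> D" "y \<in> D" "F x = w" "F y = w" by blast+
    obtain V1 V2 where V: "open V1" "x \<in> V1" "inj_on F (V1 \<inter> D)" "open V2" "y \<in> V2" "inj_on F (V2 \<inter> D)"
      using loc xyD by metis
    obtain O1 O2 where O: "open O1" "open O2" "x \<in> O1" "y \<in> O2" "O1 \<inter> O2 = {}"
      using hausdorff[OF xy(1)] by blast
    show ?thesis
    proof (rule exI[of _ "V1 \<inter> D \<inter> O1"], rule exI[of _ "V2 \<inter> D \<inter> O2"], intro conjI)
      show "V1 \<inter> D \<inter> O1 \<inter> (V2 \<inter> D \<inter> O2) = {}" using O(5) by blast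
      show "w \<in> F ` (V1 \<inter> D \<inter> O1)" by (rule image_eqI[of _ _ x]) (use V O xyD in auto)
      show "w \<in> F ` (V2 \<inter> D \<inter> O2)" by (rule image_eqI[of _ _ y]) (use V O xyD in auto)
      show "inj_on F (V1 \<inter> D \<inter> O1)" "inj_on F (V2 \<inter> D \<inter> O2)"
        using V(3,6) by (auto intro: inj_on_subset)
      show "open (V1 \<inter> D \<inter> O1)" "open (V2 \<inter> D \<inter> O2)" using V O D by (auto intro!: open_Int)
    qed auto
  qed
  have cov: "covering_space D F UNIV"
    unfolding covering_space_def
  proof (intro conjI ballI)
    show "F ` D = UNIV"
    proof -
      have "w \<in> F ` D" for w using nbhd[of w] by blast
      then show ?thesis by blast
    qed
    fix w
    obtain U1 U2 where U: "open U1" "open U2" "U1 \<subseteq> D" "U2 \<subseteq> D" "U1 \<inter> U2 = {}" "inj_on F U1" "inj_on F U2"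
      "w \<in> F ` U1" "w \<in> F ` U2" using nbhd[of w] by blast
    have img: "open (F ` V)" if "open V" "V \<subseteq> U1 \<or> V \<subseteq> U2" for V
    proof (rule invariance_of_domain)
      have "V \<subseteq> D" using that U by blast
      then show "continuous_on V F" using F continuous_on_subset by blast
      show "inj_on F V" using that U(6,7) by (auto intro: inj_on_subset)
    qed (fact that)
    \<comment> \<open>\<open>T\<close> is evenly covered: each of its points has one preimage in
      \<open>U1\<close> and one in \<open>U2\<close>, and these exhaust the fibre.\<close>
    define T where "T = F ` U1 \<inter> F ` U2"
    have T: "open T" "w \<in> T" unfolding T_def using img U by blast+
    define v where "v = {U1 \<inter> F -` T, U2 \<inter> F -` T}"
    have Vop: "open (U1 \<inter> F -` T)" "open (U2 \<inter> F -` T)"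
      using U(1-4) T(1) F by (blast intro: continuous_open_preimage continuous_on_subset)+
    show "\<exists>T. w \<in> T \<and> openin (top_of_set UNIV) T \<and> (\<exists>v. \<Union> v = D \<inter> F -` T \<and>
      (\<forall>u\<in>v. openin (top_of_set D) u) \<and> pairwise disjnt v \<and> (\<forall>u\<in>v. \<exists>q. homeomorphism u T F q))"
    proof (intro exI[of _ T] exI[of _ v] conjI)
      show "w \<in> T" "openin (top_of_set UNIV) T" using T by simp_all
      have "z \<in> U1 \<union> U2" if zD: "z \<in> D" and zT: "F z \<in> T" for z
      proof -
        obtain a where a: "a \<in> U1" "F a = F z" using zT unfolding T_def by auto
        obtain b where b: "b \<in> U2" "F b = F z" using zT unfolding T_def by auto
        have "a \<noteq> b" using a b U(5) by blast
        obtain x y where xy: "{u \<in> D. F u = F z} = {x, y}" using two[of "F z"] card_2_iff by metis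
        have "a \<in> {u \<in> D. F u = F z}" "b \<in> {u \<in> D. F u = F z}" "z \<in> {u \<in> D. F u = F z}"
          using a b U(3,4) zD by auto
        then have "z = a \<or> z = b" using \<open>a \<noteq> b\<close> unfolding xy by auto
        then show ?thesis using a b by blast
      qed
      then show "\<Union> v = D \<inter> F -` T" unfolding v_def using U(3,4) by auto
      show "\<forall>u\<in>v. openin (top_of_set D) u"
        unfolding v_def using Vop U(3,4) D(1) by (auto simp: openin_open_eq)
      show "pairwise disjnt v" unfolding v_def pairwise_def disjnt_def using U(5) by auto
      show "\<forall>u\<in>v. \<exists>q. homeomorphism u T F q"
      proof
        fix u assume "u \<in> v"
        have "F ` (U1 \<inter> F -` T) = T" "F ` (U2 \<inter> F -` T) = T"
          unfolding image_Int_vimage by (auto simp: T_def)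
        with \<open>u \<in> v\<close> have u: "open u" "u \<subseteq> D" "F ` u = T"
          unfolding v_def using Vop U(3,4) by auto
        have i: "inj_on F u"
          using \<open>u \<in> v\<close> U(6,7) unfolding v_def by (auto intro: inj_on_subset)
        obtain q where "homeomorphism u (F ` u) F q"
          by (rule invariance_of_domain_homeomorphism[OF u(1) continuous_on_subset[OF F u(2)] _ i]) auto
        then show "\<exists>q. homeomorphism u T F q" using u(3) by auto
      qed
    qed
  qed (fact F)
  \<comment> \<open>A section of the cover has clopen image, hence is onto the connected set \<open>D\<close>, so \<open>F\<close> is injective.\<close>
  obtain s where s: "continuous_on UNIV s" "s \<in> UNIV \<rightarrow> D" "\<And>y. F (s y) = y"
    using covering_space_lift[OF cov convex_imp_simply_connected[OF convex_UNIV]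
        convex_imp_locally_path_connected[OF convex_UNIV], of id]
    by (auto simp: Pi_iff)
  have "open (range s)"
    by (rule invariance_of_domain[OF s(1) open_UNIV]) (metis injI s(3))
  moreover have "range s = {x \<in> D. s (F x) = x}" using s by (auto simp: Pi_iff) (metis rangeI)
  moreover have "closedin (top_of_set D) {x \<in> D. s (F x) - x = 0}"
    by (intro continuous_closedin_preimage_constant continuous_intros
        continuous_on_compose2[OF s(1) F]) auto
  ultimately have "openin (top_of_set D) (range s)" "closedin (top_of_set D) (range s)"
    using s(2) by (auto simp: openin_open_eq[OF D(1)] Pi_iff)
  then have "range s = D" using D(2) by (metis connected_clopen empty_is_image empty_not_UNIV)
  then have "inj_on F D" using s(3) by (metis inj_on_def rangeE)
  obtain x y where ne: "x \<noteq> y" and xy: "{z \<in> D. F z = 0} = {x, y}" using two card_2_iff by metis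
  have "x \<in> {z \<in> D. F z = 0}" "y \<in> {z \<in> D. F z = 0}" unfolding xy by simp_all
  then have "x \<in> D" "y \<in> D" "F x = F y" "x \<noteq> y" using ne by simp_all
  then show False using \<open>inj_on F D\<close> by (meson inj_onD)
qed

section \<open>Planar charts of the sphere\<close>

text \<open>Three-space is modelled as \<open>complex \<times> real\<close>, so that its equatorial
  plane is identified with \<open>complex\<close> by \<open>fst\<close>.\<close>

lemma S2_homeomorphic_sphere:
  obtains f :: "(nat \<Rightarrow> real) \<Rightarrow> complex \<times> real" and g
  where "homeomorphic_maps S2 (top_of_set (sphere 0 1)) f g"
proof -
  have "card (Basis :: (complex \<times> real) set) = 3" by simp
  then show ?thesis
    using homeomorphic_maps_nsphere_euclidean_sphere[of "Basis :: (complex \<times> real) set" 3]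
      independent_Basis orthogonal_Basis that
    by (auto simp: norm_Basis)
qed

lemma compact_space_S2: "compact_space S2" and Hausdorff_space_S2: "Hausdorff_space S2"
proof -
  obtain f :: "(nat \<Rightarrow> real) \<Rightarrow> complex \<times> real" and g
    where "homeomorphic_maps S2 (top_of_set (sphere 0 1)) f g" using S2_homeomorphic_sphere by blast
  then have h: "S2 homeomorphic_space top_of_set (sphere (0 :: complex \<times> real) 1)"
    unfolding homeomorphic_space_def by blast
  show "compact_space S2"
    using homeomorphic_compact_space[OF h] by (simp add: compact_space_subtopology compactin_euclidean_iff)
  show "Hausdorff_space S2"
    using homeomorphic_Hausdorff_space[OF h] by (simp add: Hausdorff_space_subtopology)
qed

text \<open>Coordinates with \<open>N\<close> at infinity, as in stereographic projection. The value
  of \<open>e\<close> at \<open>N\<close> is left open, and the inverse \<open>e'\<close> is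
  recorded because maps are transported in both directions.\<close>

definition planar_chart ::
    "(nat \<Rightarrow> real) \<Rightarrow> ((nat \<Rightarrow> real) \<Rightarrow> complex) \<Rightarrow> (complex \<Rightarrow> nat \<Rightarrow> real) \<Rightarrow> bool"
  where "planar_chart N e e' \<longleftrightarrow> N \<in> topspace S2 \<and>
    homeomorphic_maps (subtopology S2 (topspace S2 - {N})) euclidean e e'"

text \<open>Stereographic projection from \<open>N\<close>, followed by a translation that brings
  \<open>p\<close> to the origin.\<close>

lemma planar_chart_exists:
  assumes N: "N \<in> topspace S2" and p: "p \<in> topspace S2" "p \<noteq> N"
  obtains e e' where "planar_chart N e e'" "e p = 0"
proof -
  obtain f :: "(nat \<Rightarrow> real) \<Rightarrow> complex \<times> real" and g
    where fg: "homeomorphic_maps S2 (top_of_set (sphere 0 1)) f g" using S2_homeomorphic_sphere by blast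
  have fN: "f N \<in> sphere 0 1" and gf: "\<And>x. x \<in> topspace S2 \<Longrightarrow> g (f x) = x"
    and fS: "\<And>x. x \<in> topspace S2 \<Longrightarrow> f x \<in> sphere 0 1"
    and gS: "\<And>y. y \<in> sphere 0 1 \<Longrightarrow> g y \<in> topspace S2 \<and> f (g y) = y"
    using fg N by (auto simp: homeomorphic_maps_def continuous_map_def Pi_iff)
  have "f ` (topspace S2 \<inter> (topspace S2 - {N})) = topspace (top_of_set (sphere 0 1)) \<inter> (sphere 0 1 - {f N})"
  proof (intro equalityI subsetI)
    fix y assume "y \<in> f ` (topspace S2 \<inter> (topspace S2 - {N}))"
    then obtain x where x: "y = f x" "x \<in> topspace S2" "x \<noteq> N" by blast
    then have "f x \<noteq> f N" using gf N by metis
    then show "y \<in> topspace (top_of_set (sphere 0 1)) \<inter> (sphere 0 1 - {f N})" using x fS by auto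
  next
    fix y assume "y \<in> topspace (top_of_set (sphere 0 1)) \<inter> (sphere 0 1 - {f N})"
    then have "y \<in> sphere 0 1" "y \<noteq> f N" by auto
    then show "y \<in> f ` (topspace S2 \<inter> (topspace S2 - {N}))"
      using gS[of y] by (intro image_eqI[of _ _ "g y"]) auto
  qed
  from homeomorphic_maps_subtopologies[OF fg this]
  have 1: "homeomorphic_maps (subtopology S2 (topspace S2 - {N})) (top_of_set (sphere 0 1 - {f N})) f g"
    by (simp add: subtopology_subtopology Int_absorb1)
  have "(sphere 0 1 - {f N}) homeomorphic {x :: complex \<times> real. (0, 1) \<bullet> x = 0}"
    by (rule homeomorphic_punctured_sphere_hyperplane) (use fN in \<open>auto simp: zero_prod_def\<close>)
  also have "{x :: complex \<times> real. (0, 1) \<bullet> x = 0} homeomorphic (UNIV :: complex set)"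
  proof (rule homeomorphicI[of fst _ _ "\<lambda>z. (z, 0)"])
    show "fst ` {x :: complex \<times> real. (0, 1) \<bullet> x = 0} = UNIV"
      by (force simp: image_iff inner_prod_def)
  qed (auto intro!: continuous_intros simp: inner_prod_def image_iff)
  finally obtain a b where "homeomorphism (sphere 0 1 - {f N}) (UNIV :: complex set) a b"
    unfolding homeomorphic_def by blast
  then have "homeomorphic_maps (top_of_set (sphere 0 1 - {f N})) (euclidean :: complex topology) a b"
    unfolding homeomorphism_def homeomorphic_maps_def by (auto simp: continuous_map_in_subtopology)
  from homeomorphic_maps_compose[OF conjI[OF 1 this]]
  have 2: "homeomorphic_maps (subtopology S2 (topspace S2 - {N})) (euclidean :: complex topology) (a \<circ> f) (g \<circ> b)" .
  have 3: "homeomorphic_maps euclidean euclidean (\<lambda>z. z - a (f p)) (\<lambda>z. z + a (f p))"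
    unfolding homeomorphic_maps_def by (auto intro!: continuous_intros)
  have "planar_chart N ((\<lambda>z. z - a (f p)) \<circ> (a \<circ> f)) ((g \<circ> b) \<circ> (\<lambda>z. z + a (f p)))"
    unfolding planar_chart_def using homeomorphic_maps_compose[OF conjI[OF 2 3]] N by blast
  then show ?thesis by (rule that) simp
qed

lemma planar_chartD:
  assumes "planar_chart N e e'"
  shows "N \<in> topspace S2" "\<And>z. e' z \<in> topspace S2" "\<And>z. e' z \<noteq> N" "\<And>z. e (e' z) = z"
    "\<And>x. x \<in> topspace S2 \<Longrightarrow> x \<noteq> N \<Longrightarrow> e' (e x) = x"
    "continuous_map (subtopology S2 (topspace S2 - {N})) euclidean e"
    "continuous_map euclidean S2 e'"
proof -
  from assms have c: "N \<in> topspace S2" "homeomorphic_maps (subtopology S2 (topspace S2 - {N})) euclidean e e'"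
    by (auto simp: planar_chart_def)
  from c(2) show "continuous_map euclidean S2 e'"
    by (auto simp: homeomorphic_maps_def intro: continuous_map_into_fulltopology)
qed (use assms in \<open>auto simp: planar_chart_def homeomorphic_maps_def continuous_map_def Pi_iff\<close>)

lemma openin_S2_delete: "x \<in> topspace S2 \<Longrightarrow> openin S2 (topspace S2 - {x})"
  using closedin_Hausdorff_singleton[OF Hausdorff_space_S2] by (simp add: closedin_def)

lemma planar_chart_open_image:
  assumes c: "planar_chart N e e'" and U: "open U"
  shows "openin S2 (e' ` U)"
proof -
  note d = planar_chartD[OF c]
  have "openin (subtopology S2 (topspace S2 - {N})) {x \<in> topspace (subtopology S2 (topspace S2 - {N})). e x \<in> U}"
    using d(6) U by (intro openin_continuous_map_preimage) auto
  moreover have "{x \<in> topspace (subtopology S2 (topspace S2 - {N})). e x \<in> U} = e' ` U"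
    using d(2-5) by (auto simp: image_iff) metis
  ultimately have "openin (subtopology S2 (topspace S2 - {N})) (e' ` U)" by metis
  then show ?thesis using openin_S2_delete[OF d(1)] openin_trans_full by blast
qed

lemma planar_chart_open_preimage:
  assumes c: "planar_chart N e e'" and V: "openin S2 V"
  shows "open (e' -` V)"
  using openin_continuous_map_preimage[OF planar_chartD(7)[OF c] V] by (simp add: vimage_def)

text \<open>The complement of \<open>V\<close> is compact and misses the pole, so its image in the
  plane is bounded.\<close>

lemma planar_chart_eventually:
  assumes c: "planar_chart N e e'" and V: "openin S2 V" "N \<in> V"
  shows "eventually (\<lambda>z. e' z \<in> V) at_infinity"
proof -
  note d = planar_chartD[OF c]
  have "compactin S2 (topspace S2 - V)"
    using V compact_space_S2 closedin_compact_space by blast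
  moreover have "topspace S2 - V \<subseteq> topspace S2 - {N}" using V by blast
  ultimately have "compactin (subtopology S2 (topspace S2 - {N})) (topspace S2 - V)"
    by (simp add: compactin_subtopology)
  from image_compactin[OF this d(6)] have "bounded (e ` (topspace S2 - V))"
    by (simp add: compact_imp_bounded compactin_euclidean_iff)
  then obtain B where B: "\<And>x. x \<in> topspace S2 - V \<Longrightarrow> norm (e x) \<le> B"
    by (auto simp: bounded_iff)
  have "e' z \<in> V" if "B + 1 \<le> norm z" for z
    using B[of "e' z"] d(2,4)[of z] that by force
  then show ?thesis unfolding eventually_at_infinity by blast
qed

text \<open>The complement is the image of a closed disc, which is compact and hence closed in the
  Hausdorff sphere.\<close>

lemma planar_chart_open_nhd_infinity:
  assumes c: "planar_chart N e e'"
  shows "openin S2 (insert N (e' ` {z. R < norm z}))"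
proof -
  note d = planar_chartD[OF c]
  have "compactin S2 (e' ` cball 0 R)"
    using image_compactin[OF _ d(7)] by (simp add: compactin_euclidean_iff)
  then have "closedin S2 (e' ` cball 0 R)"
    using Hausdorff_space_S2 compactin_imp_closedin by blast
  then have "openin S2 (topspace S2 - e' ` cball 0 R)" by blast
  moreover have "topspace S2 - e' ` cball 0 R = insert N (e' ` {z. R < norm z})"
  proof (intro equalityI subsetI)
    fix x assume x: "x \<in> topspace S2 - e' ` cball 0 R"
    show "x \<in> insert N (e' ` {z. R < norm z})"
    proof (cases "x = N")
      case False
      then have "x = e' (e x)" using d(5) x by simp
      moreover have "R < norm (e x)"
      proof (rule ccontr)
        assume "\<not> R < norm (e x)"
        then have "e' (e x) \<in> e' ` cball 0 R" by simp
        then show False using x \<open>x = e' (e x)\<close> by simp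
      qed
      ultimately show ?thesis by blast
    qed simp
  next
    fix x assume "x \<in> insert N (e' ` {z. R < norm z})"
    then consider "x = N" | z where "x = e' z" "R < norm z" by blast
    then show "x \<in> topspace S2 - e' ` cball 0 R"
    proof cases
      case 1 then show ?thesis using d(1,3) by force
    next
      case 2
      have "x \<noteq> e' w" if "w \<in> cball 0 R" for w
      proof
        assume "x = e' w"
        then have "w = z" using 2 d(4)[of w] d(4)[of z] by simp
        then show False using 2 that by simp
      qed
      then have "x \<notin> e' ` cball 0 R" by blast
      then show ?thesis using 2 d(2)[of z] by simp
    qed
  qed
  ultimately show ?thesis by simp
qed

section \<open>Extension of planar maps to the sphere\<close>

definition sphere_extension ::
    "(nat \<Rightarrow> real) \<Rightarrow> ((nat \<Rightarrow> real) \<Rightarrow> complex) \<Rightarrow> (nat \<Rightarrow> real) \<Rightarrow> (complex \<Rightarrow> nat \<Rightarrow> real) \<Rightarrow>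
      (complex \<Rightarrow> complex) \<Rightarrow> (nat \<Rightarrow> real) \<Rightarrow> nat \<Rightarrow> real"
  where "sphere_extension c e d E' G x = (if x = c then d else E' (G (e x)))"

text \<open>Away from \<open>c\<close> this is a composite of continuous maps. At \<open>c\<close>,
  continuity expresses that \<open>G\<close> tends to infinity, since neighbourhoods of a pole
  correspond to neighbourhoods of infinity.\<close>

lemma continuous_map_sphere_extension:
  assumes c: "planar_chart c e e'" and d: "planar_chart d E E'"
    and G: "continuous_on UNIV G" and inf: "filterlim G at_infinity at_infinity"
  shows "continuous_map S2 S2 (sphere_extension c e d E' G)"
proof -
  note cD = planar_chartD[OF c] and dD = planar_chartD[OF d]
  let ?f = "sphere_extension c e d E' G"
  have "openin S2 {x \<in> topspace S2. ?f x \<in> V}" if V: "openin S2 V" for V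
  proof -
    define W where "W = G -` (E' -` V)"
    have "open W" unfolding W_def
      using G planar_chart_open_preimage[OF d V] by (simp add: open_vimage)
    then have oW: "openin S2 (e' ` W)" by (rule planar_chart_open_image[OF c])
    have off: "{x \<in> topspace S2. ?f x \<in> V} - {c} = e' ` W"
    proof (intro equalityI subsetI)
      fix x assume "x \<in> {x \<in> topspace S2. ?f x \<in> V} - {c}"
      then have "x = e' (e x)" "e x \<in> W" using cD(5) by (auto simp: sphere_extension_def W_def)
      then show "x \<in> e' ` W" by blast
    next
      fix x assume "x \<in> e' ` W"
      then show "x \<in> {x \<in> topspace S2. ?f x \<in> V} - {c}"
        using cD(2-4) by (auto simp: sphere_extension_def W_def)
    qed
    show ?thesis
    proof (cases "d \<in> V")
      case False
      then have "{x \<in> topspace S2. ?f x \<in> V} = e' ` W" using off by (auto simp: sphere_extension_def)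
      then show ?thesis using oW by simp
    next
      case True
      have "eventually (\<lambda>z. E' z \<in> V) at_infinity" by (rule planar_chart_eventually[OF d V True])
      then have "eventually (\<lambda>z. z \<in> W) at_infinity"
        using inf unfolding filterlim_iff W_def by (auto simp: vimage_def)
      then obtain R where R: "\<And>z. R \<le> norm z \<Longrightarrow> z \<in> W" unfolding eventually_at_infinity by blast
      then have "e' ` {z. R < norm z} \<subseteq> e' ` W" by (intro image_mono) auto
      moreover have "c \<in> {x \<in> topspace S2. ?f x \<in> V}" using cD True by (simp add: sphere_extension_def)
      ultimately have "{x \<in> topspace S2. ?f x \<in> V} = insert c (e' ` {z. R < norm z}) \<union> e' ` W"
        using off by blast
      then show ?thesis using openin_Un[OF planar_chart_open_nhd_infinity[OF c] oW] by metis
    qed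
  qed
  moreover have "?f x \<in> topspace S2" for x using dD by (simp add: sphere_extension_def)
  ultimately show ?thesis by (simp add: continuous_map_def)
qed

text \<open>The inverse maps a closed disc to a bounded set, so values of \<open>G\<close> in that
  disc occur only at bounded arguments.\<close>

lemma homeomorphism_UNIV_tends_to_infinity:
  fixes G :: "complex \<Rightarrow> complex"
  assumes "homeomorphism UNIV UNIV G G'"
  shows "filterlim G at_infinity at_infinity"
  unfolding filterlim_at_infinity[OF order_refl]
proof (intro allI impI)
  fix r :: real assume "0 < r"
  have G': "continuous_on UNIV G'" "\<And>x. G' (G x) = x" using assms by (auto simp: homeomorphism_def)
  have "compact (G' ` cball 0 r)"
    using continuous_on_subset[OF G'(1)] by (intro compact_continuous_image) auto
  then obtain B where B: "\<And>z. z \<in> cball 0 r \<Longrightarrow> norm (G' z) \<le> B"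
    using compact_imp_bounded[OF \<open>compact (G' ` cball 0 r)\<close>] unfolding bounded_iff by blast
  have "r \<le> norm (G z)" if "B + 1 \<le> norm z" for z
    using B[of "G z"] G'(2)[of z] that by (cases "norm (G z) \<le> r") auto
  then show "eventually (\<lambda>z. r \<le> norm (G z)) at_infinity" unfolding eventually_at_infinity by blast
qed

lemma homeomorphic_maps_sphere_extension:
  assumes c: "planar_chart c e e'" and d: "planar_chart d E E'"
    and G: "homeomorphism UNIV UNIV G G'"
  shows "homeomorphic_maps S2 S2 (sphere_extension c e d E' G) (sphere_extension d E c e' G')"
proof -
  have G2: "homeomorphism UNIV UNIV G' G" using G by (rule homeomorphism_symD)
  have inv: "G' (G z) = z" "G (G' z) = z" for z using G by (auto simp: homeomorphism_def)
  have "continuous_map S2 S2 (sphere_extension c e d E' G)"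
    using continuous_map_sphere_extension[OF c d homeomorphism_cont1[OF G] homeomorphism_UNIV_tends_to_infinity[OF G]] .
  moreover have "continuous_map S2 S2 (sphere_extension d E c e' G')"
    using continuous_map_sphere_extension[OF d c homeomorphism_cont1[OF G2] homeomorphism_UNIV_tends_to_infinity[OF G2]] .
  ultimately show ?thesis
    unfolding homeomorphic_maps_def
    using planar_chartD(3-5)[OF c] planar_chartD(3-5)[OF d]
    by (simp add: inv sphere_extension_def)
qed

text \<open>The straight-line homotopy from the identity to \<open>f\<close> is stationary far out
  and therefore extends over the pole. Its stages may fail to be homeomorphisms; a homotopy is
  enough to determine the mapping degree.\<close>

lemma homotopic_id_sphere_extension:
  assumes c: "planar_chart N e e'" and f: "continuous_on UNIV f"
    and R: "\<And>z. R < norm z \<Longrightarrow> f z = z"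
  shows "homotopic_with (\<lambda>_. True) S2 S2 id (sphere_extension N e N e' f)"
proof -
  note d = planar_chartD[OF c]
  define I where "I = top_of_set {0..1 :: real}"
  define A where "A = topspace S2 - {N}"
  define B where "B = insert N (e' ` {z. R < norm z})"
  define k where "k = (\<lambda>(t :: real, z). (1 - t) *\<^sub>R z + t *\<^sub>R f z)"
  define H where "H = (\<lambda>(t, x). if x = N then N else e' (k (t, e x)))"
  have kc: "continuous_map (prod_topology euclidean euclidean) euclidean k"
    unfolding k_def split_def
    by (simp, intro continuous_intros continuous_on_compose2[OF f]) auto
  have k1: "k (t, z) = z" if "R < norm z" for t z
    using R[OF that] by (simp add: k_def algebra_simps)
  have opA: "openin S2 A" unfolding A_def by (rule openin_S2_delete[OF d(1)])
  have opB: "openin S2 B" unfolding B_def by (rule planar_chart_open_nhd_infinity[OF c])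
  have ec: "continuous_map (subtopology S2 A) euclidean e" using d(6) by (simp add: A_def)
  have H1: "continuous_map (prod_topology I (subtopology S2 A)) S2 (\<lambda>(t, x). e' (k (t, e x)))"
  proof -
    have "continuous_map (prod_topology I (subtopology S2 A)) (prod_topology euclidean euclidean) (\<lambda>(t, x). (t, e x))"
      unfolding continuous_map_pairwise split_def o_def fst_conv snd_conv
      using continuous_map_compose[OF continuous_map_snd ec, of I]
      by (auto simp: I_def o_def intro: continuous_map_into_fulltopology continuous_map_fst)
    from continuous_map_compose[OF continuous_map_compose[OF this kc] d(7)]
    show ?thesis by (simp add: o_def split_def)
  qed
  have H2: "continuous_map (prod_topology I (subtopology S2 B)) S2 snd"
    by (rule continuous_map_into_fulltopology[OF continuous_map_snd])
  \<comment> \<open>Glued from the chart formula off the pole and the projection to the second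
    factor near the pole, where \<open>k\<close> moves no point.\<close>
  have "continuous_map (prod_topology I S2) S2 H"
  proof (rule pasting_lemma[where I = "UNIV :: bool set"
        and T = "\<lambda>b. if b then topspace I \<times> A else topspace I \<times> B"
        and f = "\<lambda>b. if b then (\<lambda>(t, x). e' (k (t, e x))) else snd"])
    show "openin (prod_topology I S2) (if b then topspace I \<times> A else topspace I \<times> B)" for b
      using opA opB by (simp add: openin_prod_Times_iff)
    show "continuous_map (subtopology (prod_topology I S2) (if b then topspace I \<times> A else topspace I \<times> B)) S2
        (if b then (\<lambda>(t, x). e' (k (t, e x))) else snd)" for b
      using H1 H2 by (cases b) (simp_all only: if_True if_False subtopology_Times subtopology_topspace)
    have agree: "e' (k (t, e x)) = x" if "x \<in> A" "x \<in> B" for t x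
    proof -
      have "R < norm (e x)" using that d(4) by (auto simp: A_def B_def)
      then show ?thesis using k1 d(5) that by (simp add: A_def)
    qed
    show "(if i then (\<lambda>(t, x). e' (k (t, e x))) else snd) x = (if j then (\<lambda>(t, x). e' (k (t, e x))) else snd) x"
      if "x \<in> topspace (prod_topology I S2) \<inter> (if i then topspace I \<times> A else topspace I \<times> B)
          \<inter> (if j then topspace I \<times> A else topspace I \<times> B)" for i j x
      using that agree by (cases i; cases j) auto
    show "\<exists>j. j \<in> UNIV \<and> x \<in> (if j then topspace I \<times> A else topspace I \<times> B)
        \<and> H x = (if j then (\<lambda>(t, x). e' (k (t, e x))) else snd) x"
      if x: "x \<in> topspace (prod_topology I S2)" for x
    proof (cases "snd x = N")
      case True
      then show ?thesis using x by (intro exI[of _ False]) (auto simp: B_def H_def split_def)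
    next
      case False
      then show ?thesis using x by (intro exI[of _ True]) (auto simp: A_def H_def split_def)
    qed
  qed
  then have cH: "continuous_map (prod_topology (top_of_set {0..1}) S2) S2 H" by (simp add: I_def)
  have "homotopic_with (\<lambda>_. True) S2 S2 (\<lambda>x. H (0, x)) (\<lambda>x. H (1, x))"
    unfolding homotopic_with_def using cH by (intro exI[of _ H]) auto
  then show ?thesis
  proof (rule homotopic_with_eq)
    show "id x = H (0, x)" if "x \<in> topspace S2" for x
      using that d(5)[of x] by (simp add: H_def k_def)
    show "sphere_extension N e N e' f x = H (1, x)" if "x \<in> topspace S2" for x
      by (simp add: H_def k_def sphere_extension_def)
  qed simp
qed

section \<open>Moving finitely many points of the sphere\<close>

lemma infinite_S2: "infinite (topspace S2)"
proof -
  have "(\<lambda>n. if n = 0 then 1 else 0) \<in> topspace S2" "(\<lambda>n. if n = 1 then 1 else 0) \<in> topspace S2"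
    by (auto simp: nsphere numeral_2_eq_2)
  moreover have "(\<lambda>n. if n = 1 then 1 else 0 :: real) \<noteq> (\<lambda>n :: nat. if n = 0 then 1 else 0)"
    by (auto simp: fun_eq_iff)
  ultimately obtain N e e' where "planar_chart N e e'" using planar_chart_exists by metis
  note d = planar_chartD[OF this]
  have "inj e'" using d(4) by (metis injI)
  then have "infinite (range e')" using infinite_UNIV_char_0 finite_imageD by blast
  moreover have "range e' \<subseteq> topspace S2" using d(2) by blast
  ultimately show ?thesis using finite_subset by blast
qed

text \<open>With the pole away from all points involved, a plane homeomorphism of bounded support
  moves them as required. Bounded support makes its extension homotopic to the identity, so the
  degree is 1.\<close>

lemma orientation_preserving_homeo_moving_points:
  assumes fin: "finite P" and P: "P \<subseteq> topspace S2" and inj: "inj_on a P" and aP: "a ` P \<subseteq> topspace S2"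
  obtains \<alpha> where "orientation_preserving_homeo \<alpha>" "\<And>p. p \<in> P \<Longrightarrow> \<alpha> p = a p"
proof -
  have f1: "finite (P \<union> a ` P)" using fin by simp
  obtain N where N: "N \<in> topspace S2" "N \<notin> P \<union> a ` P"
    using infinite_S2 f1 by (meson finite_subset subsetI)
  obtain q where q: "q \<in> topspace S2" "q \<noteq> N"
    using infinite_S2 by (metis finite.emptyI finite_insert finite_subset insert_iff subsetI)
  obtain e e' where c: "planar_chart N e e'" using planar_chart_exists[OF N(1) q] by blast
  note d = planar_chartD[OF c]
  have ei: "e x \<noteq> e y" if "x \<in> topspace S2" "y \<in> topspace S2" "x \<noteq> N" "y \<noteq> N" "x \<noteq> y" for x y
    using d(5) that by metis
  have pw: "pairwise (\<lambda>i j. e i \<noteq> e j \<and> e (a i) \<noteq> e (a j)) P"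
    unfolding pairwise_def
  proof (intro ballI impI conjI)
    fix i j assume ij: "i \<in> P" "j \<in> P" "i \<noteq> j"
    then have "a i \<noteq> a j" using inj by (auto dest: inj_onD)
    have "i \<in> topspace S2" "j \<in> topspace S2" "a i \<in> topspace S2" "a j \<in> topspace S2"
      "i \<noteq> N" "j \<noteq> N" "a i \<noteq> N" "a j \<noteq> N" using ij N P aP by auto
    then show "e i \<noteq> e j" "e (a i) \<noteq> e (a j)" using ij(3) \<open>a i \<noteq> a j\<close> ei by blast+
  qed
  obtain f g where fg: "homeomorphism UNIV UNIV f g" "\<And>i. i \<in> P \<Longrightarrow> f (e i) = e (a i)"
    "bounded {x. \<not> (f x = x \<and> g x = x)}"
    by (rule homeomorphism_moving_points_exists[of UNIV UNIV P e "\<lambda>i. e (a i)"])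
      (use fin pw in \<open>auto simp: affine_hull_UNIV\<close>)
  obtain R where R: "\<And>x. x \<in> {x. \<not> (f x = x \<and> g x = x)} \<Longrightarrow> norm x \<le> R"
    using fg(3) unfolding bounded_iff by blast
  have fR: "f z = z" if "R < norm z" for z using R[of z] that by auto
  let ?\<alpha> = "sphere_extension N e N e' f"
  have "Brouwer_degree2 2 id = Brouwer_degree2 2 ?\<alpha>"
    by (rule Brouwer_degree2_homotopic, rule homotopic_id_sphere_extension[OF c _ fR])
      (use fg(1) in \<open>auto simp: homeomorphism_def\<close>)
  then have "orientation_preserving ?\<alpha>" by (simp add: orientation_preserving_def)
  moreover have "homeomorphic_map S2 S2 ?\<alpha>"
    using homeomorphic_maps_sphere_extension[OF c c fg(1)] homeomorphic_maps_map by blast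
  moreover have "?\<alpha> p = a p" if "p \<in> P" for p
  proof -
    have "a p \<in> topspace S2" "a p \<noteq> N" "p \<noteq> N" using that N aP by auto
    then show ?thesis using fg(2)[OF that] d(5) by (simp add: sphere_extension_def)
  qed
  ultimately show ?thesis using that unfolding orientation_preserving_homeo_def by blast
qed

section \<open>Maps of degree two\<close>

text \<open>One of the two charts in \<open>locally_power_map_at\<close>, isolated so that source
  and target charts are transported by the same lemma.\<close>

definition disc_chart ::
    "(nat \<Rightarrow> real) \<Rightarrow> (nat \<Rightarrow> real) set \<Rightarrow> ((nat \<Rightarrow> real) \<Rightarrow> complex) \<Rightarrow> bool"
  where "disc_chart x U u \<longleftrightarrow> openin S2 U \<and> x \<in> U \<and>
    homeomorphic_map (subtopology S2 U) (top_of_set (ball 0 1)) u \<and> u x = 0"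

lemma locally_power_map_at_iff:
  "locally_power_map_at f x \<longleftrightarrow>
    (\<exists>U V u v k. disc_chart x U u \<and> disc_chart (f x) V v \<and> f ` U \<subseteq> V \<and> (k::nat) \<ge> 1 \<and>
      (\<forall>p\<in>U. v (f p) = u p ^ k))"
proof -
  have "f x \<in> V" if "f ` U \<subseteq> V" "x \<in> U" for U V using that by blast
  then show ?thesis unfolding locally_power_map_at_def disc_chart_def by (intro iff_exI) blast
qed

lemma disc_chartD:
  assumes "disc_chart x U u"
  shows "openin S2 U" "U \<subseteq> topspace S2" "x \<in> U" "u x = 0" "inj_on u U" "u ` U = ball 0 1"
    "\<And>W. openin S2 W \<Longrightarrow> W \<subseteq> U \<Longrightarrow> open (u ` W)"
    "\<And>T. open T \<Longrightarrow> openin S2 {p \<in> U. u p \<in> T}"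
proof -
  have h: "homeomorphic_map (subtopology S2 U) (top_of_set (ball 0 1)) u"
    using assms by (simp add: disc_chart_def)
  show U: "openin S2 U" "x \<in> U" "u x = 0" using assms by (simp_all add: disc_chart_def)
  then show sub: "U \<subseteq> topspace S2" using openin_subset by blast
  then have top: "topspace (subtopology S2 U) = U" by (rule topspace_subtopology_subset)
  show "inj_on u U" using homeomorphic_imp_injective_map[OF h] top by simp
  show "u ` U = ball 0 1" using homeomorphic_imp_surjective_map[OF h] top by simp
  show "open (u ` W)" if "openin S2 W" "W \<subseteq> U" for W
  proof -
    have "openin (subtopology S2 U) W" using that by (auto simp: openin_subtopology)
    then have "openin (top_of_set (ball 0 1)) (u ` W)"
      using homeomorphic_imp_open_map[OF h] by (simp add: open_map_def)
    then show ?thesis using open_ball openin_open_trans by blast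
  qed
  show "openin S2 {p \<in> U. u p \<in> T}" if "open T" for T
  proof -
    have "continuous_map (subtopology S2 U) euclidean u"
      using homeomorphic_imp_continuous_map[OF h] continuous_map_into_fulltopology by blast
    then have "openin (subtopology S2 U) {p \<in> topspace (subtopology S2 U). u p \<in> T}"
      by (rule openin_continuous_map_preimage) (simp add: that)
    then show ?thesis unfolding top using openin_trans_full U(1) by blast
  qed
qed

lemma power_map_small_ball:
  fixes w z :: complex
  assumes "norm w < r ^ k" "z ^ k = w" "k \<ge> 1" "r > 0"
  shows "norm z < r"
proof -
  have "norm z ^ k < r ^ k" using assms by (metis norm_power)
  then show ?thesis by (rule power_less_imp_less_base) (use assms in simp)
qed

text \<open>A nonzero number has exactly \<open>k\<close> roots of order \<open>k\<close>, all small
  if the number is small, so they all come from the prescribed neighbourhood \<open>W\<close>. This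
  bounds the number of preimages of nearby values from below.\<close>

lemma power_map_preimages:
  assumes u: "disc_chart x U u" and v: "disc_chart y V v" and fUV: "f ` U \<subseteq> V" and k: "(k::nat) \<ge> 1"
    and eq: "\<And>p. p \<in> U \<Longrightarrow> v (f p) = u p ^ k" and W: "openin S2 W" "x \<in> W"
  obtains Y where "openin S2 Y" "y \<in> Y" "\<And>q. q \<in> Y - {y} \<Longrightarrow> \<exists>A\<subseteq>W \<inter> U. card A = k \<and> f ` A \<subseteq> {q}"
proof -
  note ud = disc_chartD[OF u] and vd = disc_chartD[OF v]
  have "openin S2 (W \<inter> U)" using W ud by blast
  then have "open (u ` (W \<inter> U))" by (rule ud(7)) simp
  moreover have "0 \<in> u ` (W \<inter> U)" using W ud by force
  ultimately obtain r where r: "r > 0" "ball 0 r \<subseteq> u ` (W \<inter> U)" by (meson openE)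
  \<comment> \<open>The radius \<open>r ^ k\<close> confines the roots of \<open>v q\<close> to the
    ball of radius \<open>r\<close>, which lies in the chart image of
    \<open>W \<inter> U\<close>.\<close>
  define Y where "Y = {q \<in> V. v q \<in> ball 0 (r ^ k)}"
  show ?thesis
  proof
    show "openin S2 Y" unfolding Y_def by (rule vd(8)) simp
    show "y \<in> Y" using vd r by (simp add: Y_def)
    fix q assume q: "q \<in> Y - {y}"
    then have qV: "q \<in> V" "norm (v q) < r ^ k" by (auto simp: Y_def)
    have nz: "v q \<noteq> 0" using q qV vd(3-5) by (metis DiffD2 inj_onD singletonI)
    define A where "A = {p \<in> W \<inter> U. u p ^ k = v q}"
    have "{z. z ^ k = v q} \<subseteq> u ` A"
    proof
      fix z assume "z \<in> {z. z ^ k = v q}"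
      then have z: "z ^ k = v q" by simp
      then have "norm z < r" using power_map_small_ball qV(2) k r(1) by blast
      then obtain p where "p \<in> W \<inter> U" "z = u p" using r(2) by force
      then show "z \<in> u ` A" using z by (auto simp: A_def)
    qed
    moreover have "u ` A \<subseteq> {z. z ^ k = v q}" by (auto simp: A_def)
    ultimately have "u ` A = {z. z ^ k = v q}" by blast
    then have "card (u ` A) = k" using card_nth_roots[OF nz] k by simp
    moreover have "inj_on u A" using ud(5) by (rule inj_on_subset) (auto simp: A_def)
    ultimately have "card A = k" by (simp add: card_image)
    moreover have "f p = q" if "p \<in> A" for p
    proof -
      have "p \<in> U" "v (f p) = v q" using that eq by (auto simp: A_def)
      moreover have "f p \<in> V" using \<open>p \<in> U\<close> fUV by blast
      ultimately show ?thesis using inj_onD[OF vd(5)] qV(1) by blast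
    qed
    ultimately show "\<exists>A\<subseteq>W \<inter> U. card A = k \<and> f ` A \<subseteq> {q}"
      by (intro exI[of _ A]) (auto simp: A_def)
  qed
qed

text \<open>The power map covers the punctured plane and so is injective near \<open>u p\<close>.
  Since \<open>u\<close> is injective, \<open>v \<circ> f\<close> is injective near
  \<open>p\<close>, and with it \<open>f\<close>.\<close>

lemma power_map_locally_injective_off_center:
  assumes u: "disc_chart x U u" and k: "(k::nat) \<ge> 1"
    and eq: "\<And>p. p \<in> U \<Longrightarrow> v (f p) = u p ^ k" and p: "p \<in> U" "p \<noteq> x"
  shows "\<exists>W. openin S2 W \<and> p \<in> W \<and> inj_on f W"
proof -
  note ud = disc_chartD[OF u]
  have "u p \<noteq> 0" using p ud(3,4) inj_onD[OF ud(5), of p x] by auto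
  then have "u p \<in> - {0}" by simp
  have cov: "covering_space (- {0}) (\<lambda>z :: complex. z ^ k) (- {0})"
    using k by (intro covering_space_power_punctured_plane) simp
  obtain T S q where T: "u p \<in> T" "openin (top_of_set (- {0})) T" "homeomorphism T S (\<lambda>z. z ^ k) q"
    by (rule covering_space_local_homeomorphism[OF cov \<open>u p \<in> - {0}\<close>])
  have "open T" by (rule openin_open_trans[OF T(2) open_Compl[OF closed_singleton]])
  then have "openin S2 {p \<in> U. u p \<in> T}" by (rule ud(8))
  moreover have "inj_on f {p \<in> U. u p \<in> T}"
  proof (rule inj_onI)
    fix a b assume a: "a \<in> {p \<in> U. u p \<in> T}" and b: "b \<in> {p \<in> U. u p \<in> T}" and "f a = f b"
    then have e: "u a ^ k = u b ^ k" using a b eq[of a] eq[of b] by simp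
    have "u a = q (u a ^ k)" using a homeomorphism_apply1[OF T(3)] by auto
    also have "\<dots> = q (u b ^ k)" by (subst e) (rule refl)
    also have "\<dots> = u b" using b homeomorphism_apply1[OF T(3)] by auto
    finally have "u a = u b" .
    then show "a = b" using a b inj_onD[OF ud(5), of a b] by simp
  qed
  ultimately show ?thesis using p T(1) by blast
qed

text \<open>
  Orientation is left out so that the class is closed under composition with arbitrary homeomorphisms.
\<close>

definition double_cover :: "((nat \<Rightarrow> real) \<Rightarrow> nat \<Rightarrow> real) \<Rightarrow> bool"
  where "double_cover f \<longleftrightarrow>
    continuous_map S2 S2 f \<and> (\<forall>x\<in>topspace S2. locally_power_map_at f x) \<and> quadratic f"

lemma double_cover_power_charts:
  assumes "double_cover f" "x \<in> topspace S2"
  obtains U V u v k where "disc_chart x U u" "disc_chart (f x) V v" "f ` U \<subseteq> V" "(k::nat) \<ge> 1"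
    "\<And>p. p \<in> U \<Longrightarrow> v (f p) = u p ^ k"
proof -
  have "locally_power_map_at f x" using assms by (simp add: double_cover_def)
  then show ?thesis unfolding locally_power_map_at_iff using that by (elim exE conjE) simp
qed

section \<open>Counting preimages under a double cover\<close>

lemma infinite_openin_S2:
  assumes "openin S2 V" "x \<in> V"
  shows "infinite V"
proof -
  have x: "x \<in> topspace S2" using assms openin_subset by blast
  obtain N where N: "N \<in> topspace S2" "x \<noteq> N"
    using infinite_S2 by (metis finite.emptyI finite_insert finite_subset insert_iff subsetI)
  obtain e e' where c: "planar_chart N e e'" using planar_chart_exists[OF N(1) x N(2)] by blast
  note d = planar_chartD[OF c]
  have "e x \<in> e' -` V" using d(5) x N assms by simp
  then have "infinite (e' -` V)"
    using planar_chart_open_preimage[OF c assms(1)] finite_imp_not_open by blast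
  moreover have "inj_on e' (e' -` V)" using d(4) by (metis inj_onI)
  ultimately have "infinite (e' ` (e' -` V))" using finite_imageD by blast
  moreover have "e' ` (e' -` V) \<subseteq> V" by blast
  ultimately show ?thesis using finite_subset by blast
qed

text \<open>In a power chart only the centre can be critical, and finitely many such charts cover
  the compact sphere.\<close>

lemma critical_set_finite:
  assumes f: "\<And>x. x \<in> topspace S2 \<Longrightarrow> locally_power_map_at f x"
  shows "finite (critical_set f)"
proof -
  have "\<exists>U. openin S2 U \<and> x \<in> U \<and> critical_set f \<inter> U \<subseteq> {x}" if x: "x \<in> topspace S2" for x
  proof -
    obtain U V u v k where d: "disc_chart x U u" "disc_chart (f x) V v" "f ` U \<subseteq> V" "(k::nat) \<ge> 1"
      "\<And>p. p \<in> U \<Longrightarrow> v (f p) = u p ^ k"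
      using f[OF x] unfolding locally_power_map_at_iff by blast
    have "critical_set f \<inter> U \<subseteq> {x}"
      using power_map_locally_injective_off_center[OF d(1,4), of v f] d(5) unfolding critical_set_def by blast
    then show ?thesis using disc_chartD[OF d(1)] by blast
  qed
  then obtain U where U: "\<And>x. x \<in> topspace S2 \<Longrightarrow> openin S2 (U x) \<and> x \<in> U x \<and> critical_set f \<inter> U x \<subseteq> {x}"
    by metis
  have "\<exists>\<F>. finite \<F> \<and> \<F> \<subseteq> U ` topspace S2 \<and> topspace S2 \<subseteq> \<Union>\<F>"
    by (rule compact_space_S2[unfolded compact_space_alt, rule_format]) (use U in auto)
  then obtain K where K: "finite K" "K \<subseteq> topspace S2" "topspace S2 \<subseteq> \<Union>(U ` K)"
    using finite_subset_image by metis
  have "critical_set f \<subseteq> K"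
  proof
    fix c assume c: "c \<in> critical_set f"
    then have "c \<in> topspace S2" by (simp add: critical_set_def)
    then obtain x where "x \<in> K" "c \<in> U x" using K by blast
    then show "c \<in> K" using U[of x] K c by blast
  qed
  then show ?thesis using K finite_subset by blast
qed

lemma double_cover_open_map:
  assumes "double_cover f" "openin S2 W"
  shows "openin S2 (f ` W)"
proof (subst openin_subopen, rule ballI)
  fix y assume "y \<in> f ` W"
  then obtain x where x: "x \<in> W" "y = f x" by blast
  then have "x \<in> topspace S2" using assms openin_subset by blast
  then obtain U V u v k where d: "disc_chart x U u" "disc_chart (f x) V v" "f ` U \<subseteq> V" "(k::nat) \<ge> 1"
    "\<And>p. p \<in> U \<Longrightarrow> v (f p) = u p ^ k"
    using double_cover_power_charts[OF assms(1)] by metis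
  obtain Y where Y: "openin S2 Y" "f x \<in> Y"
    "\<And>q. q \<in> Y - {f x} \<Longrightarrow> \<exists>A\<subseteq>W \<inter> U. card A = k \<and> f ` A \<subseteq> {q}"
    using power_map_preimages[OF d assms(2) x(1)] by blast
  have "q \<in> f ` W" if "q \<in> Y" for q
  proof (cases "q = f x")
    case False
    then obtain A where A: "A \<subseteq> W \<inter> U" "card A = k" "f ` A \<subseteq> {q}" using Y(3) \<open>q \<in> Y\<close> by blast
    then have "A \<noteq> {}" using d(4) by auto
    then show ?thesis using A by blast
  qed (use x in simp)
  then show "\<exists>T. openin S2 T \<and> y \<in> T \<and> T \<subseteq> f ` W" using Y x by blast
qed

lemma double_cover_regular_fibre:
  assumes "double_cover f" "y \<in> topspace S2" "y \<notin> f ` critical_set f"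
  shows "card {x \<in> topspace S2. f x = y} = 2"
  using assms by (simp add: double_cover_def quadratic_def has_degree_def)

text \<open>Nonempty open sets are infinite, whereas the critical values are finite in number.
  Replacing a value by a nearby generic one turns questions about fibres into counts against
  2.\<close>

lemma double_cover_generic_point:
  assumes f: "double_cover f" and Y: "openin S2 Y" "y \<in> Y" and F: "finite F"
  obtains q where "q \<in> Y - F" "card {x \<in> topspace S2. f x = q} = 2"
proof -
  have "finite (f ` critical_set f \<union> F)"
    using critical_set_finite f F by (auto simp: double_cover_def)
  then obtain q where q: "q \<in> Y" "q \<notin> f ` critical_set f \<union> F"
    using infinite_openin_S2[OF Y] by (meson finite_subset subsetI)
  moreover have "q \<in> topspace S2" using q Y openin_subset by blast
  ultimately show ?thesis using that double_cover_regular_fibre[OF f] by blast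
qed

lemma S2_separate:
  assumes "x \<in> topspace S2" "y \<in> topspace S2" "x \<noteq> y"
  obtains A B where "openin S2 A" "openin S2 B" "x \<in> A" "y \<in> B" "A \<inter> B = {}"
  using Hausdorff_space_S2 assms unfolding Hausdorff_space_def disjnt_def by metis

text \<open>Three distinct preimages have disjoint neighbourhoods whose images share an open set. A
  generic value in it would have a preimage in each neighbourhood, hence three in all.\<close>

lemma double_cover_no_three_preimages:
  assumes f: "double_cover f"
    and xyz: "x \<in> topspace S2" "y \<in> topspace S2" "z \<in> topspace S2" and fe: "f x = f y" "f y = f z"
  shows "x = y \<or> y = z \<or> x = z"
proof (rule ccontr)
  assume "\<not> (x = y \<or> y = z \<or> x = z)"
  then have ne: "x \<noteq> y" "y \<noteq> z" "x \<noteq> z" by auto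
  obtain A1 B1 where 1: "openin S2 A1" "openin S2 B1" "x \<in> A1" "y \<in> B1" "A1 \<inter> B1 = {}"
    using S2_separate[OF xyz(1,2) ne(1)] by blast
  obtain B2 C2 where 2: "openin S2 B2" "openin S2 C2" "y \<in> B2" "z \<in> C2" "B2 \<inter> C2 = {}"
    using S2_separate[OF xyz(2,3) ne(2)] by blast
  obtain A3 C3 where 3: "openin S2 A3" "openin S2 C3" "x \<in> A3" "z \<in> C3" "A3 \<inter> C3 = {}"
    using S2_separate[OF xyz(1,3) ne(3)] by blast
  let ?Y = "f ` (A1 \<inter> A3) \<inter> f ` (B1 \<inter> B2) \<inter> f ` (C2 \<inter> C3)"
  have op: "openin S2 ?Y"
    using 1 2 3 by (intro openin_Int double_cover_open_map[OF f])
  have mem: "f x \<in> ?Y"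
    using 1 2 3 fe by (metis IntI image_eqI)
  obtain q where "q \<in> ?Y - {}" and card: "card {x \<in> topspace S2. f x = q} = 2"
    by (rule double_cover_generic_point[OF f op mem finite.emptyI])
  then have q: "q \<in> f ` (A1 \<inter> A3)" "q \<in> f ` (B1 \<inter> B2)" "q \<in> f ` (C2 \<inter> C3)" by simp_all
  obtain a where a: "a \<in> A1 \<inter> A3" "f a = q" using q(1) by auto
  obtain b where b: "b \<in> B1 \<inter> B2" "f b = q" using q(2) by auto
  obtain c where c: "c \<in> C2 \<inter> C3" "f c = q" using q(3) by auto
  have abc: "a \<in> A1" "a \<in> A3" "b \<in> B1" "b \<in> B2" "c \<in> C2" "c \<in> C3" "f a = q" "f b = q" "f c = q"
    using a b c by simp_all
  then have "{a, b, c} \<subseteq> {x \<in> topspace S2. f x = q}"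
    using openin_subset[OF 1(1)] openin_subset[OF 1(2)] openin_subset[OF 2(2)] by auto
  moreover have "card {a, b, c} = 3"
  proof -
    have "a \<noteq> b" using abc(1,3) 1(5) by blast
    moreover have "b \<noteq> c" using abc(4,5) 2(5) by blast
    moreover have "a \<noteq> c" using abc(2,6) 3(5) by blast
    ultimately show ?thesis by simp
  qed
  moreover have "finite {x \<in> topspace S2. f x = q}" using card by (intro card_ge_0_finite) simp
  ultimately show False using card card_mono[of "{x \<in> topspace S2. f x = q}" "{a, b, c}"] by simp
qed

text \<open>The local degree \<open>k\<close> exceeds 1 because \<open>f\<close> is not injective
  near \<open>c\<close>, and it is at most 2 because a nearby generic value has only two preimages.
  Those two already lie near \<open>c\<close>, so a second point in the fibre of \<open>f c\<close>
  would contribute a third.\<close>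

lemma double_cover_at_critical_point:
  assumes f: "double_cover f" and c: "c \<in> critical_set f"
  obtains U V u v where "disc_chart c U u" "disc_chart (f c) V v" "f ` U \<subseteq> V"
    "\<And>p. p \<in> U \<Longrightarrow> v (f p) = (u p)\<^sup>2"
    "\<And>x. x \<in> topspace S2 \<Longrightarrow> f x = f c \<Longrightarrow> x = c"
proof -
  have cS: "c \<in> topspace S2" using c by (simp add: critical_set_def)
  then obtain U V u v k where d: "disc_chart c U u" "disc_chart (f c) V v" "f ` U \<subseteq> V" "(k::nat) \<ge> 1"
    "\<And>p. p \<in> U \<Longrightarrow> v (f p) = u p ^ k"
    using double_cover_power_charts[OF f] by metis
  note ud = disc_chartD[OF d(1)]
  have "k \<noteq> 1"
  proof
    assume "k = 1"
    then have "inj_on f U" using d(5) ud(5) unfolding inj_on_def by simp metis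
    then show False using c ud by (auto simp: critical_set_def)
  qed
  then have k2: "k \<ge> 2" using d(4) by simp
  have fin: "finite {x \<in> topspace S2. f x = q}" if "card {x \<in> topspace S2. f x = q} = 2" for q
    using that by (intro card_ge_0_finite) simp
  have "k = 2"
  proof -
    obtain Y where Y: "openin S2 Y" "f c \<in> Y"
      "\<And>q. q \<in> Y - {f c} \<Longrightarrow> \<exists>A\<subseteq>U \<inter> U. card A = k \<and> f ` A \<subseteq> {q}"
      using power_map_preimages[OF d ud(1,3)] by blast
    obtain q where q: "q \<in> Y - {f c}" "card {x \<in> topspace S2. f x = q} = 2"
      by (rule double_cover_generic_point[OF f Y(1,2), of "{f c}"]) auto
    obtain A where A: "A \<subseteq> U" "card A = k" "f ` A \<subseteq> {q}" using Y(3)[OF q(1)] by auto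
    then have "A \<subseteq> {x \<in> topspace S2. f x = q}" using ud(2) by blast
    then have "k \<le> 2" using card_mono[OF fin[OF q(2)]] A q by metis
    then show ?thesis using k2 by simp
  qed
  moreover have "x = c" if x: "x \<in> topspace S2" "f x = f c" for x
  proof (rule ccontr)
    assume "x \<noteq> c"
    then obtain P Q where PQ: "openin S2 P" "openin S2 Q" "x \<in> P" "c \<in> Q" "P \<inter> Q = {}"
      using S2_separate[OF x(1) cS] by blast
    obtain Y where Y: "openin S2 Y" "f c \<in> Y"
      "\<And>q. q \<in> Y - {f c} \<Longrightarrow> \<exists>A\<subseteq>Q \<inter> U. card A = k \<and> f ` A \<subseteq> {q}"
      using power_map_preimages[OF d PQ(2,4)] by blast
    \<comment> \<open>Apart from \<open>f c\<close>, a value in this set has \<open>k\<close>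
      preimages in \<open>Q\<close> and another one in \<open>P\<close>.\<close>
    have "openin S2 (Y \<inter> f ` P)" by (rule openin_Int[OF Y(1) double_cover_open_map[OF f PQ(1)]])
    moreover have "f c \<in> Y \<inter> f ` P" using Y(2) imageI[OF PQ(3), of f] x(2) by simp
    ultimately obtain q where q: "q \<in> Y \<inter> f ` P - {f c}" "card {x \<in> topspace S2. f x = q} = 2"
      by (rule double_cover_generic_point[OF f, of "Y \<inter> f ` P" "f c" "{f c}"]) auto
    obtain A where A: "A \<subseteq> Q \<inter> U" "card A = k" "f ` A \<subseteq> {q}" using Y(3)[of q] q(1) by auto
    obtain p where p: "p \<in> P" "f p = q" using q(1) by blast
    have "p \<notin> A" using p PQ A by blast
    have "finite A" using A(2) k2 card.infinite by force
    then have "card (insert p A) = k + 1" using \<open>p \<notin> A\<close> A by simp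
    moreover have "insert p A \<subseteq> {x \<in> topspace S2. f x = q}"
      using A p ud(2) openin_subset[OF PQ(1)] by auto
    ultimately have "k + 1 \<le> 2" using card_mono[OF fin[OF q(2)]] q(2) by metis
    then show False using k2 by simp
  qed
  ultimately show ?thesis using d that by blast
qed

section \<open>The planar model of a double cover\<close>

lemma critical_set_subset: "critical_set f \<subseteq> topspace S2"
  by (auto simp: critical_set_def)

lemma double_cover_in_S2: "double_cover f \<Longrightarrow> x \<in> topspace S2 \<Longrightarrow> f x \<in> topspace S2"
  by (auto simp: double_cover_def continuous_map_def Pi_iff)

lemma planar_chart_coordinate_map:
  assumes f: "continuous_map S2 S2 f" and c: "planar_chart c e e'" and d: "planar_chart d E E'"
    and D: "\<And>z. z \<in> D \<Longrightarrow> f (e' z) \<noteq> d"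
  shows "continuous_on D (\<lambda>z. E (f (e' z)))"
proof -
  have 1: "continuous_map (top_of_set D) S2 (f \<circ> e')"
    using continuous_map_compose[OF planar_chartD(7)[OF c] f] continuous_map_from_subtopology by blast
  have "continuous_map (top_of_set D) (subtopology S2 (topspace S2 - {d})) (f \<circ> e')"
  proof (rule continuous_map_into_subtopology[OF 1])
    show "f \<circ> e' \<in> topspace (top_of_set D) \<rightarrow> topspace S2 - {d}"
      using D continuous_map_funspace[OF 1] by (fastforce simp: Pi_iff)
  qed
  from continuous_map_compose[OF this planar_chartD(6)[OF d]]
  show ?thesis by (simp add: o_def)
qed

text \<open>In power charts \<open>f\<close> is squaring, so near \<open>c0\<close> the planar map
  has the form \<open>k ((a z)\<^sup>2)\<close> with \<open>k\<close> nonzero off the origin;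
  \<open>sqrt_of_square_substitution\<close> then supplies the root.\<close>

lemma critical_point_local_sqrt:
  assumes f: "double_cover f" and c0: "c0 \<in> critical_set f"
    and c: "planar_chart c1 e e'" and ec0: "e c0 = 0" "c0 \<noteq> c1"
    and d: "planar_chart w E E'" and w: "f c0 \<noteq> w" "E (f c0) = 0"
  obtains N s where "open N" "0 \<in> N" "continuous_on (N - {0}) s"
    "\<And>z. z \<in> N - {0} \<Longrightarrow> (s z)\<^sup>2 = E (f (e' z))"
proof -
  note cD = planar_chartD[OF c] and dD = planar_chartD[OF d]
  have c0S: "c0 \<in> topspace S2" using c0 critical_set_subset by blast
  obtain U V u v where uv: "disc_chart c0 U u" "disc_chart (f c0) V v" "f ` U \<subseteq> V"
    "\<And>p. p \<in> U \<Longrightarrow> v (f p) = (u p)\<^sup>2"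
    using double_cover_at_critical_point[OF f c0] by metis
  note ud = disc_chartD[OF uv(1)] and vd = disc_chartD[OF uv(2)]
  obtain vi where vi: "homeomorphic_maps (subtopology S2 V) (top_of_set (ball 0 1)) v vi"
    using uv(2) unfolding disc_chart_def homeomorphic_map_maps by blast
  have topV: "topspace (subtopology S2 V) = V" using vd(2) by (rule topspace_subtopology_subset)
  have vV: "v q \<in> ball 0 1" "vi (v q) = q" if "q \<in> V" for q
    using vi that topV vd(6) by (auto simp: homeomorphic_maps_def)
  have viB: "vi z \<in> V" "v (vi z) = z" if "z \<in> ball 0 1" for z
    using vi that topV by (auto simp: homeomorphic_maps_def continuous_map_def Pi_iff)
  have "openin S2 (V - {w})" using vd(1) dD(1) openin_S2_delete
    by (metis Diff_eq Int_Diff openin_Int openin_subset inf.absorb1)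
  then have "open (v ` (V - {w}))" by (rule vd(7)) blast
  moreover have "0 \<in> v ` (V - {w})" using vd(3,4) w by force
  ultimately obtain r where r: "r > 0" "ball 0 r \<subseteq> v ` (V - {w})" by (meson openE)
  \<comment> \<open>Scaling by the square of \<open>\<rho>\<close> sends the unit disc into the unit
    disc, where \<open>vi\<close> inverts \<open>v\<close>, and into the ball of radius
    \<open>r\<close>, over which \<open>vi\<close> avoids the pole \<open>w\<close> of the target
    chart.\<close>
  define \<rho> where "\<rho> = sqrt (min r 1)"
  have \<rho>: "\<rho> > 0" "\<rho>\<^sup>2 \<le> r" "\<rho>\<^sup>2 \<le> 1" using r(1) by (auto simp: \<rho>_def)
  define B where "B = ball (0 :: complex) 1"
  define m where "m = (\<lambda>z :: complex. of_real (\<rho>\<^sup>2) * z)"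
  have mB: "m z \<in> ball 0 r" "m z \<in> ball 0 1" if "z \<in> B" for z
  proof -
    have "\<rho>\<^sup>2 * norm z < \<rho>\<^sup>2 * 1" using that \<rho> by (intro mult_strict_left_mono) (auto simp: B_def)
    then have "norm (m z) < \<rho>\<^sup>2" by (simp add: m_def norm_mult norm_power)
    then show "m z \<in> ball 0 r" "m z \<in> ball 0 1" using \<rho> by auto
  qed
  have viw: "vi (m z) \<in> V" "vi (m z) \<noteq> w" "v (vi (m z)) = m z" if zB: "z \<in> B" for z
  proof -
    show a: "vi (m z) \<in> V" "v (vi (m z)) = m z" using viB mB(2)[OF zB] by auto
    obtain q where "q \<in> V - {w}" "m z = v q" using mB(1)[OF zB] r(2) by blast
    then show "vi (m z) \<noteq> w" using vV by auto
  qed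
  define k where "k = (\<lambda>z. E (vi (m z)))"
  have "continuous_on B k"
  proof -
    have "continuous_map (top_of_set B) (top_of_set (ball 0 1)) m"
      using mB by (auto simp: continuous_map_in_subtopology m_def intro!: continuous_intros)
    moreover have "continuous_map (top_of_set (ball 0 1)) S2 vi"
      using vi by (auto simp: homeomorphic_maps_def intro: continuous_map_into_fulltopology)
    ultimately have "continuous_map (top_of_set B) S2 (vi \<circ> m)" by (rule continuous_map_compose)
    then have "continuous_map (top_of_set B) (subtopology S2 (topspace S2 - {w})) (vi \<circ> m)"
      by (rule continuous_map_into_subtopology) (use viw vd(2) in \<open>fastforce simp: Pi_iff\<close>)
    from continuous_map_compose[OF this dD(6)] show ?thesis by (simp add: o_def k_def)
  qed
  moreover have "k z \<noteq> 0" if "z \<in> B - {0}" for z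
  proof
    assume "k z = 0"
    have zB: "z \<in> B" using that by simp
    have "vi (m z) = E' (E (vi (m z)))" using dD(5) viw[OF zB] vd(2) by (metis subsetD)
    also have "\<dots> = E' (E (f c0))" using \<open>k z = 0\<close> w by (simp add: k_def)
    also have "\<dots> = f c0" using dD(5) w vd(2,3) by blast
    finally have "m z = 0" using viw(3)[OF zB] vd(4) by simp
    then show False using that \<rho> by (simp add: m_def)
  qed
  ultimately obtain s where s: "continuous_on (B - {0}) s" "\<And>z. z \<in> B - {0} \<Longrightarrow> (s z)\<^sup>2 = k (z\<^sup>2)"
    using sqrt_of_square_substitution[of k] unfolding B_def by metis
  \<comment> \<open>On \<open>N\<close> the coordinate \<open>u\<close> is smaller than
    \<open>\<rho>\<close>, so the rescaled coordinate \<open>a\<close> stays in the unit disc, and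
    \<open>m\<close> undoes the scaling after squaring.\<close>
  define N where "N = e' -` {p \<in> U. u p \<in> ball 0 \<rho>}"
  define a where "a = (\<lambda>z. u (e' z) / of_real \<rho>)"
  have e'0: "e' 0 = c0" using cD(5)[OF c0S ec0(2)] ec0 by simp
  have aN: "a z \<in> B" if "z \<in> N" for z
    using that \<rho>(1) by (auto simp: N_def a_def B_def norm_divide)
  have a0: "a z \<noteq> 0" if "z \<in> N - {0}" for z
  proof
    assume "a z = 0"
    then have "u (e' z) = u c0" using \<rho>(1) ud(4) by (simp add: a_def)
    moreover have "e' z \<in> U" using that by (simp add: N_def)
    ultimately have "e' z = c0" using ud(3) inj_onD[OF ud(5)] by blast
    then show False using e'0 cD(4) that by (metis DiffD2 singletonI)
  qed
  show ?thesis
  proof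
    show "open N" unfolding N_def by (intro planar_chart_open_preimage[OF c] ud(8)) simp
    show "0 \<in> N" using ud(3,4) \<rho>(1) e'0 by (simp add: N_def)
    have "continuous_map (top_of_set N) (subtopology S2 U) e'"
      using planar_chartD(7)[OF c] by (auto simp: continuous_map_in_subtopology N_def intro: continuous_map_from_subtopology)
    moreover have "continuous_map (subtopology S2 U) euclidean u"
      using uv(1) homeomorphic_imp_continuous_map continuous_map_into_fulltopology
      unfolding disc_chart_def by blast
    ultimately have "continuous_on N (\<lambda>z. u (e' z))"
      using continuous_map_compose by (fastforce simp: o_def)
    then have "continuous_on N a" unfolding a_def using \<rho>(1) by (intro continuous_intros) auto
    then have "continuous_on (N - {0}) a" by (rule continuous_on_subset) blast
    then show "continuous_on (N - {0}) (\<lambda>z. s (a z))"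
      by (rule continuous_on_compose2[OF s(1)]) (use aN a0 in auto)
    fix z assume z: "z \<in> N - {0}"
    then have "a z \<in> B - {0}" using aN a0 by auto
    then have "(s (a z))\<^sup>2 = k ((a z)\<^sup>2)" by (rule s(2))
    also have "m ((a z)\<^sup>2) = (u (e' z))\<^sup>2" using \<rho>(1) by (simp add: m_def a_def power_divide)
    then have "k ((a z)\<^sup>2) = E (vi ((u (e' z))\<^sup>2))" by (simp add: k_def)
    also have "(u (e' z))\<^sup>2 = v (f (e' z))" using uv(4)[of "e' z"] z by (simp add: N_def)
    also have "vi (v (f (e' z))) = f (e' z)" using vV(2) uv(3) z by (auto simp: N_def)
    finally show "(s (a z))\<^sup>2 = E (f (e' z))" .
  qed
qed

text \<open>The fibre of \<open>f c1\<close> is \<open>{c1}\<close>, so the planar map is defined on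
  the whole plane and tends to infinity at infinity. The fibre of \<open>f c0\<close> is
  \<open>{c0}\<close>, so it vanishes only at the origin, where
  \<open>critical_point_local_sqrt\<close> gives the local root.\<close>

theorem double_cover_is_square_of_homeo:
  assumes f: "double_cover f" and c0: "c0 \<in> critical_set f" and c1: "c1 \<in> critical_set f" and ne: "c0 \<noteq> c1"
    and c: "planar_chart c1 e e'" and ec0: "e c0 = 0"
    and d: "planar_chart (f c1) E E'" and w: "E (f c0) = 0"
  obtains G G' where "homeomorphism UNIV UNIV G G'" "\<And>z. (G z)\<^sup>2 = E (f (e' z))"
proof -
  note cD = planar_chartD[OF c] and dD = planar_chartD[OF d]
  have contf: "continuous_map S2 S2 f" using f by (simp add: double_cover_def)
  have c0S: "c0 \<in> topspace S2" using c0 critical_set_subset by blast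
  have fib0: "x = c0" if "x \<in> topspace S2" "f x = f c0" for x
    using double_cover_at_critical_point[OF f c0] that by metis
  have fib1: "x = c1" if "x \<in> topspace S2" "f x = f c1" for x
    using double_cover_at_critical_point[OF f c1] that by metis
  have w01: "f c0 \<noteq> f c1" using fib1 c0S ne by blast
  have off: "f (e' z) \<noteq> f c1" for z using fib1 cD(2,3) by blast
  define F where "F = (\<lambda>z. E (f (e' z)))"
  have E'F: "E' (F z) = f (e' z)" for z
    unfolding F_def by (rule dD(5)[OF double_cover_in_S2[OF f cD(2)] off])
  have F: "continuous_on UNIV F"
    unfolding F_def by (rule planar_chart_coordinate_map[OF contf c d off])
  have F0: "F z = 0 \<longleftrightarrow> z = 0" for z
  proof
    assume "F z = 0"
    then have "f (e' z) = E' (E (f c0))" using E'F w by metis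
    then have "f (e' z) = f c0" using dD(5) w01 double_cover_in_S2[OF f c0S] by simp
    then have "e' z = c0" using fib0 cD(2) by blast
    then show "z = 0" using cD(4)[of z] ec0 by simp
  next
    assume "z = 0"
    then have "e' z = c0" using cD(5)[OF c0S ne] ec0 by simp
    then show "F z = 0" using w by (simp add: F_def)
  qed
  obtain N s where N: "open N" "0 \<in> N" "continuous_on (N - {0}) s" "\<And>z. z \<in> N - {0} \<Longrightarrow> (s z)\<^sup>2 = F z"
    unfolding F_def using critical_point_local_sqrt[OF f c0 c ec0 ne d w01 w] by metis
  have op: "open (F ` U)" if "open U" for U
  proof -
    have "openin S2 (f ` (e' ` U))"
      by (rule double_cover_open_map[OF f planar_chart_open_image[OF c that]])
    then have "open (E' -` (f ` (e' ` U)))" by (rule planar_chart_open_preimage[OF d])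
    moreover have "E' -` (f ` (e' ` U)) = F ` U"
    proof (intro equalityI subsetI)
      fix z assume "z \<in> E' -` (f ` (e' ` U))"
      then obtain y where "y \<in> U" "E' z = f (e' y)" by blast
      then have "z = F y" using dD(4)[of z] by (simp add: F_def)
      then show "z \<in> F ` U" using \<open>y \<in> U\<close> by blast
    next
      fix z assume "z \<in> F ` U"
      then show "z \<in> E' -` (f ` (e' ` U))" using E'F by auto
    qed
    ultimately show ?thesis by simp
  qed
  have inf: "filterlim F at_infinity at_infinity"
    unfolding filterlim_at_infinity[OF order_refl]
  proof (intro allI impI)
    fix R :: real assume "0 < R"
    let ?Y = "insert (f c1) (E' ` {z. R < norm z})"
    \<comment> \<open>The preimage of a neighbourhood of \<open>f c1\<close> is a neighbourhood of
      \<open>c1\<close>, that is, of infinity in the source chart.\<close>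
    have "openin S2 {x \<in> topspace S2. f x \<in> ?Y}"
      by (rule openin_continuous_map_preimage[OF contf planar_chart_open_nhd_infinity[OF d]])
    then have "eventually (\<lambda>z. e' z \<in> {x \<in> topspace S2. f x \<in> ?Y}) at_infinity"
      using cD(1) by (intro planar_chart_eventually[OF c]) auto
    then show "eventually (\<lambda>z. R \<le> norm (F z)) at_infinity"
    proof (rule eventually_mono)
      fix z assume "e' z \<in> {x \<in> topspace S2. f x \<in> ?Y}"
      then obtain y where "R < norm y" "f (e' z) = E' y" using off[of z] by auto
      then show "R \<le> norm (F z)" using dD(4)[of y] by (simp add: F_def)
    qed
  qed
  have fib: "x = y \<or> y = z \<or> x = z" if eq: "F x = F y" "F y = F z" for x y z
  proof -
    have "f (e' x) = f (e' y)" "f (e' y) = f (e' z)" using eq E'F by metis+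
    from double_cover_no_three_preimages[OF f cD(2) cD(2) cD(2) this]
    show ?thesis using cD(4) by metis
  qed
  obtain G G' where "homeomorphism UNIV UNIV G G'" "\<And>z. (G z)\<^sup>2 = F z"
    using plane_double_cover_is_square_of_homeo[OF F F0 N op inf fib] by metis
  then show ?thesis using that unfolding F_def by blast
qed

text \<open>With at most one critical point, all critical values would equal a single
  \<open>w\<close>. Removing \<open>w\<close> and its finite fibre would leave an unramified
  two-sheeted cover of a plane by a connected set, against
  \<open>no_connected_double_cover_of_plane\<close>.\<close>

lemma double_cover_two_critical_points:
  assumes f: "double_cover f"
  obtains c0 c1 where "c0 \<in> critical_set f" "c1 \<in> critical_set f" "c0 \<noteq> c1"
proof (rule ccontr)
  assume no: "\<not> thesis"
  have contf: "continuous_map S2 S2 f" using f by (simp add: double_cover_def)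
  have one: "x = y" if "x \<in> critical_set f" "y \<in> critical_set f" for x y
    using that no \<open>\<And>c0 c1. c0 \<in> critical_set f \<Longrightarrow> c1 \<in> critical_set f \<Longrightarrow> c0 \<noteq> c1 \<Longrightarrow> thesis\<close> by blast
  \<comment> \<open>\<open>w\<close> is the critical value if there is one and an arbitrary point
    otherwise.\<close>
  have "\<exists>w\<in>topspace S2. f ` critical_set f \<subseteq> {w} \<and> finite {x \<in> topspace S2. f x = w} \<and> {x \<in> topspace S2. f x = w} \<noteq> {}"
  proof (cases "critical_set f = {}")
    case True
    obtain w where w: "w \<in> topspace S2" using infinite_S2 by fastforce
    then have card: "card {x \<in> topspace S2. f x = w} = 2"
      using double_cover_regular_fibre[OF f] True by blast
    then have "finite {x \<in> topspace S2. f x = w}" by (intro card_ge_0_finite) simp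
    moreover have "{x \<in> topspace S2. f x = w} \<noteq> {}"
    proof
      assume "{x \<in> topspace S2. f x = w} = {}"
      then show False using card by (simp only: card.empty)
    qed
    ultimately show ?thesis using w True by blast
  next
    case False
    then obtain x where x: "x \<in> critical_set f" by blast
    then have xS: "x \<in> topspace S2" using critical_set_subset by blast
    have "y = x" if "y \<in> topspace S2" "f y = f x" for y
      using double_cover_at_critical_point[OF f x] that by metis
    then have "{y \<in> topspace S2. f y = f x} = {x}" using xS by blast
    moreover have "f ` critical_set f \<subseteq> {f x}" using one x by blast
    ultimately show ?thesis using double_cover_in_S2[OF f xS] by (intro bexI[of _ "f x"]) simp_all
  qed
  then obtain w where w: "w \<in> topspace S2" "f ` critical_set f \<subseteq> {w}"
    and Q: "finite {x \<in> topspace S2. f x = w}" "{x \<in> topspace S2. f x = w} \<noteq> {}" by blast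
  define Q where "Q = {x \<in> topspace S2. f x = w}"
  obtain q where q: "q \<in> Q" using Q(2) unfolding Q_def by blast
  then have qS: "q \<in> topspace S2" by (simp add: Q_def)
  have other: "\<exists>y\<in>topspace S2. y \<noteq> x" for x
    using infinite_S2 by (metis finite.emptyI finite_insert finite_subset insert_iff subsetI)
  obtain e e' where c: "planar_chart q e e'" using planar_chart_exists[OF qS] other by metis
  obtain E E' where d: "planar_chart w E E'" using planar_chart_exists[OF w(1)] other by metis
  note cD = planar_chartD[OF c] and dD = planar_chartD[OF d]
  \<comment> \<open>The pole \<open>q\<close> already belongs to the fibre of \<open>w\<close>, so
    what remains of the sphere without that fibre is the plane minus finitely many points.\<close>
  define D where "D = - (e ` (Q - {q}))"
  have fin: "finite (e ` (Q - {q}))" using Q(1) by (simp add: Q_def)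
  have off: "f (e' z) \<noteq> w" if "z \<in> D" for z
  proof
    assume "f (e' z) = w"
    then have "e' z \<in> Q - {q}" using cD(2,3) by (simp add: Q_def)
    then have "e (e' z) \<in> e ` (Q - {q})" by (rule imageI)
    then show False using that cD(4) by (simp add: D_def)
  qed
  define F where "F = (\<lambda>z. E (f (e' z)))"
  have E'F: "E' (F z) = f (e' z)" if "z \<in> D" for z
    unfolding F_def by (rule dD(5)[OF double_cover_in_S2[OF f cD(2)] off[OF that]])
  show False
  proof (rule no_connected_double_cover_of_plane)
    show "open D" unfolding D_def using fin by (simp add: finite_imp_closed open_Compl)
    show "connected D"
      unfolding D_def Compl_eq_Diff_UNIV
      by (rule connected_open_delete_finite) (use fin in auto)
    show "continuous_on D F"
      unfolding F_def by (rule planar_chart_coordinate_map[OF contf c d off])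
    show "\<exists>U. open U \<and> z \<in> U \<and> inj_on F (U \<inter> D)" if z: "z \<in> D" for z
    proof -
      have "e' z \<notin> critical_set f" using off[OF z] w(2) by blast
      then obtain W where W: "openin S2 W" "e' z \<in> W" "inj_on f W"
        using cD(2) unfolding critical_set_def by blast
      have "inj_on F (e' -` W \<inter> D)"
      proof (rule inj_onI)
        fix a b assume a: "a \<in> e' -` W \<inter> D" and b: "b \<in> e' -` W \<inter> D" and "F a = F b"
        then have "f (e' a) = f (e' b)" using E'F[of a] E'F[of b] by simp
        then have "e' a = e' b" using inj_onD[OF W(3)] a b by blast
        then show "a = b" using cD(4) by metis
      qed
      then show ?thesis using W(2) planar_chart_open_preimage[OF c W(1)] by blast
    qed
    show "card {z \<in> D. F z = \<zeta>} = 2" for \<zeta>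
    proof -
      have "E' \<zeta> \<notin> f ` critical_set f" using w(2) dD(3)[of \<zeta>] by blast
      then have "card {x \<in> topspace S2. f x = E' \<zeta>} = 2"
        by (rule double_cover_regular_fibre[OF f dD(2)])
      moreover have "{x \<in> topspace S2. f x = E' \<zeta>} = e' ` {z \<in> D. F z = \<zeta>}"
      proof (intro equalityI subsetI)
        fix x assume x: "x \<in> {x \<in> topspace S2. f x = E' \<zeta>}"
        then have xQ: "x \<notin> Q" using dD(3)[of \<zeta>] by (auto simp: Q_def)
        then have xe: "e' (e x) = x" using cD(5) x q by blast
        have "e x \<in> D"
        proof (rule ccontr)
          assume "e x \<notin> D"
          then obtain y where y: "y \<in> Q - {q}" "e x = e y" unfolding D_def by blast
          then have "e' (e y) = y" using cD(5) by (simp add: Q_def)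
          then show False using xe y xQ by simp
        qed
        moreover have "F (e x) = \<zeta>" using x xe dD(4) by (simp add: F_def)
        ultimately show "x \<in> e' ` {z \<in> D. F z = \<zeta>}" using xe by (intro image_eqI[of _ _ "e x"]) auto
      next
        fix x assume "x \<in> e' ` {z \<in> D. F z = \<zeta>}"
        then obtain z where "z \<in> D" "F z = \<zeta>" "x = e' z" by blast
        then show "x \<in> {x \<in> topspace S2. f x = E' \<zeta>}" using E'F[of z] cD(2) by simp
      qed
      moreover have "inj_on e' {z \<in> D. F z = \<zeta>}" using cD(4) by (metis inj_onI)
      ultimately show ?thesis by (simp add: card_image)
    qed
  qed
qed

text \<open>In the planar model the other point of a fibre is found by negating \<open>G\<close>. A
  critical fibre is a single point, so \<open>G\<close> vanishes at every critical point besides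
  \<open>c1\<close>, which leaves only \<open>c0\<close>.\<close>

lemma double_cover_fibres:
  assumes f: "double_cover f"
  obtains c0 c1 where "critical_set f = {c0, c1}" "c0 \<noteq> c1" "f c0 \<noteq> f c1"
    "\<And>y. y \<in> topspace S2 \<Longrightarrow> y \<noteq> f c0 \<Longrightarrow> y \<noteq> f c1 \<Longrightarrow> card {x \<in> topspace S2. f x = y} = 2"
    "\<And>x. x \<in> topspace S2 \<Longrightarrow> f x = f c0 \<Longrightarrow> x = c0"
    "\<And>x. x \<in> topspace S2 \<Longrightarrow> f x = f c1 \<Longrightarrow> x = c1"
proof -
  obtain c0 c1 where c: "c0 \<in> critical_set f" "c1 \<in> critical_set f" "c0 \<noteq> c1"
    using double_cover_two_critical_points[OF f] by blast
  have fib: "x = k" if "k \<in> critical_set f" "x \<in> topspace S2" "f x = f k" for x k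
    using double_cover_at_critical_point[OF f that(1)] that(2,3) by metis
  have S: "c0 \<in> topspace S2" "c1 \<in> topspace S2" using c critical_set_subset by blast+
  have ne: "f c0 \<noteq> f c1" using fib[OF c(2) S(1)] c(3) by blast
  obtain e e' where e: "planar_chart c1 e e'" "e c0 = 0"
    using planar_chart_exists[OF S(2,1) c(3)] by blast
  obtain E E' where E: "planar_chart (f c1) E E'" "E (f c0) = 0"
    using planar_chart_exists[OF double_cover_in_S2[OF f S(2)] double_cover_in_S2[OF f S(1)] ne] by blast
  obtain G G' where G: "homeomorphism UNIV UNIV G G'" "\<And>z. (G z)\<^sup>2 = E (f (e' z))"
    using double_cover_is_square_of_homeo[OF f c e E] by blast
  note eD = planar_chartD[OF e(1)] and ED = planar_chartD[OF E(1)]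
  have "x = c0" if x: "x \<in> critical_set f" "x \<noteq> c1" for x
  proof -
    have xS: "x \<in> topspace S2" using x critical_set_subset by blast
    \<comment> \<open>The partner of \<open>x\<close> under the deck involution that changes the
      sign of \<open>G\<close>.\<close>
    define y where "y = e' (G' (- G (e x)))"
    have yS: "y \<in> topspace S2" "y \<noteq> c1" unfolding y_def using eD(2,3) by blast+
    have fne: "f x \<noteq> f c1" "f y \<noteq> f c1" using fib[OF c(2)] xS yS x by blast+
    have "e y = G' (- G (e x))" by (simp add: y_def eD(4))
    then have Gy: "G (e y) = - G (e x)" using homeomorphism_apply2[OF G(1)] by simp
    have "E (f y) = E (f x)"
      using G(2)[of "e x"] G(2)[of "e y"] Gy eD(5)[OF xS x(2)] eD(5)[OF yS] by simp
    then have "f y = f x" using ED(5) fne double_cover_in_S2[OF f] xS yS by metis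
    then have "y = x" using fib[OF x(1) yS(1)] by blast
    then have "G (e x) = 0" using Gy by simp
    then have "E (f x) = 0" using G(2)[of "e x"] eD(5)[OF xS x(2)] by simp
    then have "f x = f c0" using ED(5)[of "f x"] ED(5)[of "f c0"] E(2) fne ne double_cover_in_S2[OF f] xS S by metis
    then show ?thesis using fib[OF c(1) xS] by blast
  qed
  then have "critical_set f = {c0, c1}" using c by blast
  moreover from this have "card {x \<in> topspace S2. f x = y} = 2"
    if "y \<in> topspace S2" "y \<noteq> f c0" "y \<noteq> f c1" for y
    using double_cover_regular_fibre[OF f that(1)] that(2,3) by simp
  ultimately show ?thesis using that c(3) ne fib[OF c(1)] fib[OF c(2)] by blast
qed

text \<open>Over a common target chart, \<open>f\<close> and \<open>h\<close> are the squares of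
  plane homeomorphisms \<open>G\<close> and \<open>K\<close>. The inverse of \<open>K\<close> after
  \<open>G\<close> therefore intertwines them, and it extends over the poles.\<close>

lemma lift_to_homeo:
  assumes f: "double_cover f" and h: "double_cover h"
    and vf: "f ` critical_set f = h ` critical_set h"
  obtains \<beta> where "homeomorphic_map S2 S2 \<beta>" "\<And>x. x \<in> topspace S2 \<Longrightarrow> h (\<beta> x) = f x"
proof -
  obtain c0 c1 where c: "critical_set f = {c0, c1}" "c0 \<noteq> c1" "f c0 \<noteq> f c1"
    using double_cover_fibres[OF f] by metis
  obtain a b where ab: "critical_set h = {a, b}" "a \<noteq> b" "h a \<noteq> h b"
    using double_cover_fibres[OF h] by metis
  \<comment> \<open>The critical points of \<open>h\<close> are relabelled so that their values
    match those of \<open>c0\<close> and \<open>c1\<close> in order.\<close>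
  have "{f c0, f c1} = {h a, h b}" using vf c ab by simp
  then obtain k0 k1 where k: "critical_set h = {k0, k1}" "k0 \<noteq> k1" "f c0 = h k0" "f c1 = h k1"
    using ab by (metis doubleton_eq_iff)
  have cc: "c0 \<in> critical_set f" "c1 \<in> critical_set f" "k0 \<in> critical_set h" "k1 \<in> critical_set h"
    using c k by simp_all
  then have S: "c0 \<in> topspace S2" "c1 \<in> topspace S2" "k0 \<in> topspace S2" "k1 \<in> topspace S2"
    using critical_set_subset by blast+
  obtain e e' where e: "planar_chart c1 e e'" "e c0 = 0"
    using planar_chart_exists[OF S(2,1) c(2)] by blast
  obtain d d' where d: "planar_chart k1 d d'" "d k0 = 0"
    using planar_chart_exists[OF S(4,3) k(2)] by blast
  obtain E E' where E: "planar_chart (f c1) E E'" "E (f c0) = 0"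
    using planar_chart_exists[OF double_cover_in_S2[OF f S(2)] double_cover_in_S2[OF f S(1)] c(3)] by blast
  obtain G G' where G: "homeomorphism UNIV UNIV G G'" "\<And>z. (G z)\<^sup>2 = E (f (e' z))"
    using double_cover_is_square_of_homeo[OF f cc(1,2) c(2) e E] by blast
  obtain K K' where K: "homeomorphism UNIV UNIV K K'" "\<And>z. (K z)\<^sup>2 = E (h (d' z))"
    using double_cover_is_square_of_homeo[OF h cc(3,4) k(2) d E[unfolded k]] by blast
  have KG: "homeomorphism UNIV UNIV (K' \<circ> G) (G' \<circ> K)"
    using homeomorphism_compose[OF G(1) homeomorphism_symD[OF K(1)]] .
  let ?\<beta> = "sphere_extension c1 e k1 d' (K' \<circ> G)"
  have "homeomorphic_map S2 S2 ?\<beta>"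
    using homeomorphic_maps_sphere_extension[OF e(1) d(1) KG] homeomorphic_maps_map by blast
  moreover have "h (?\<beta> x) = f x" if x: "x \<in> topspace S2" for x
  proof (cases "x = c1")
    case False
    note eD = planar_chartD[OF e(1)] and dD = planar_chartD[OF d(1)] and ED = planar_chartD[OF E(1)]
    let ?y = "d' (K' (G (e x)))"
    have y: "?y \<in> topspace S2" "?y \<noteq> k1" using dD(2,3) by blast+
    have "h ?y \<noteq> h k1" using double_cover_at_critical_point[OF h cc(4)] y by metis
    moreover have "f x \<noteq> f c1" using double_cover_at_critical_point[OF f cc(2)] x False by metis
    moreover have "E (h ?y) = E (f x)"
      using K(2)[of "K' (G (e x))"] G(2)[of "e x"] homeomorphism_apply2[OF K(1)] eD(5)[OF x False] by simp
    ultimately have "h ?y = f x"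
      using ED(5)[of "h ?y"] ED(5)[of "f x"] k(4) double_cover_in_S2[OF f x] double_cover_in_S2[OF h y(1)] by metis
    then show ?thesis using False by (simp add: sphere_extension_def)
  qed (simp add: sphere_extension_def k)
  ultimately show ?thesis using that by blast
qed

section \<open>Semiconjugacy and matching of finite sets\<close>

lemma homeo_S2D:
  assumes "homeomorphic_map S2 S2 \<alpha>"
  shows "continuous_map S2 S2 \<alpha>" "inj_on \<alpha> (topspace S2)" "\<alpha> ` topspace S2 = topspace S2"
    "\<And>x. x \<in> topspace S2 \<Longrightarrow> \<alpha> x \<in> topspace S2"
    "\<And>U. openin S2 U \<Longrightarrow> openin S2 (\<alpha> ` U)"
    "\<And>U. openin S2 U \<Longrightarrow> openin S2 {x \<in> topspace S2. \<alpha> x \<in> U}"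
  using assms by (auto simp: homeomorphic_eq_everything_map open_map_def intro: openin_continuous_map_preimage)

lemma disc_chart_preimage:
  assumes \<beta>: "homeomorphic_map S2 S2 \<beta>" and x: "x \<in> topspace S2" and u: "disc_chart (\<beta> x) U u"
  shows "disc_chart x {p \<in> topspace S2. \<beta> p \<in> U} (u \<circ> \<beta>)"
proof -
  note ud = disc_chartD[OF u] and b = homeo_S2D[OF \<beta>]
  have "homeomorphic_map (subtopology S2 {p \<in> topspace S2. \<beta> p \<in> U}) (subtopology S2 U) \<beta>"
    by (rule homeomorphic_map_subtopologies_alt[OF \<beta>]) simp
  moreover have "homeomorphic_map (subtopology S2 U) (top_of_set (ball 0 1)) u"
    using u by (simp add: disc_chart_def)
  ultimately have "homeomorphic_map (subtopology S2 {p \<in> topspace S2. \<beta> p \<in> U}) (top_of_set (ball 0 1)) (u \<circ> \<beta>)"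
    by (rule homeomorphic_map_compose)
  then show ?thesis using b(6)[OF ud(1)] x ud(3,4) by (simp add: disc_chart_def)
qed

text \<open>Source charts are pulled back along \<open>\<beta>\<close> and target charts along
  \<open>\<alpha>\<close>. Having two homeomorphisms covers both precomposition and postcomposition,
  with the identity for the other one.\<close>

lemma locally_power_map_at_semiconjugate:
  assumes \<alpha>: "homeomorphic_map S2 S2 \<alpha>" and \<beta>: "homeomorphic_map S2 S2 \<beta>"
    and F: "\<And>x. x \<in> topspace S2 \<Longrightarrow> F x \<in> topspace S2"
    and eq: "\<And>x. x \<in> topspace S2 \<Longrightarrow> \<alpha> (F x) = h (\<beta> x)"
    and x: "x \<in> topspace S2" and h: "locally_power_map_at h (\<beta> x)"
  shows "locally_power_map_at F x"
proof -
  obtain U V u v k where d: "disc_chart (\<beta> x) U u" "disc_chart (h (\<beta> x)) V v" "h ` U \<subseteq> V" "(k::nat) \<ge> 1"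
    "\<forall>p\<in>U. v (h p) = u p ^ k"
    using h unfolding locally_power_map_at_iff by (elim exE conjE)
  have d2: "disc_chart (\<alpha> (F x)) V v" using d(2) eq[OF x] by simp
  show ?thesis
    unfolding locally_power_map_at_iff
  proof (intro exI conjI)
    show "disc_chart x {p \<in> topspace S2. \<beta> p \<in> U} (u \<circ> \<beta>)" by (rule disc_chart_preimage[OF \<beta> x d(1)])
    show "disc_chart (F x) {p \<in> topspace S2. \<alpha> p \<in> V} (v \<circ> \<alpha>)"
      by (rule disc_chart_preimage[OF \<alpha> F[OF x] d2])
    show "F ` {p \<in> topspace S2. \<beta> p \<in> U} \<subseteq> {p \<in> topspace S2. \<alpha> p \<in> V}"
      using F eq d(3) by auto
    show "1 \<le> k" by fact
    show "\<forall>p\<in>{p \<in> topspace S2. \<beta> p \<in> U}. (v \<circ> \<alpha>) (F p) = (u \<circ> \<beta>) p ^ k"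
      using eq d(5) by simp
  qed
qed

text \<open>Since \<open>\<alpha>\<close> is injective and \<open>\<beta>\<close> is a
  homeomorphism, \<open>F\<close> is injective near \<open>x\<close> exactly when \<open>h\<close>
  is injective near \<open>\<beta> x\<close>.\<close>

lemma critical_set_semiconjugate:
  assumes \<alpha>: "homeomorphic_map S2 S2 \<alpha>" and \<beta>: "homeomorphic_map S2 S2 \<beta>"
    and F: "\<And>x. x \<in> topspace S2 \<Longrightarrow> F x \<in> topspace S2"
    and eq: "\<And>x. x \<in> topspace S2 \<Longrightarrow> \<alpha> (F x) = h (\<beta> x)"
  shows "\<beta> ` critical_set F = critical_set h"
proof -
  note a = homeo_S2D[OF \<alpha>] and b = homeo_S2D[OF \<beta>]
  have iff: "(\<exists>U. openin S2 U \<and> x \<in> U \<and> inj_on F U) \<longleftrightarrow> (\<exists>U. openin S2 U \<and> \<beta> x \<in> U \<and> inj_on h U)"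
    if x: "x \<in> topspace S2" for x
  proof
    assume "\<exists>U. openin S2 U \<and> x \<in> U \<and> inj_on F U"
    then obtain U where U: "openin S2 U" "x \<in> U" "inj_on F U" by blast
    have sub: "U \<subseteq> topspace S2" using U(1) by (rule openin_subset)
    have "inj_on h (\<beta> ` U)"
    proof (rule inj_onI)
      fix p q assume "p \<in> \<beta> ` U" "q \<in> \<beta> ` U" and hpq: "h p = h q"
      then obtain y z where yz: "y \<in> U" "p = \<beta> y" "z \<in> U" "q = \<beta> z" by blast
      then have S: "y \<in> topspace S2" "z \<in> topspace S2" using sub by blast+
      then have "\<alpha> (F y) = \<alpha> (F z)" using eq hpq yz by simp
      then have "F y = F z" using inj_onD[OF a(2)] F S by blast
      then have "y = z" using inj_onD[OF U(3)] yz by blast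
      then show "p = q" using yz by simp
    qed
    then show "\<exists>U. openin S2 U \<and> \<beta> x \<in> U \<and> inj_on h U"
      using U b(5) by (intro exI[of _ "\<beta> ` U"]) auto
  next
    assume "\<exists>U. openin S2 U \<and> \<beta> x \<in> U \<and> inj_on h U"
    then obtain U where U: "openin S2 U" "\<beta> x \<in> U" "inj_on h U" by blast
    have "inj_on F {p \<in> topspace S2. \<beta> p \<in> U}"
    proof (rule inj_onI)
      fix p q assume p: "p \<in> {p \<in> topspace S2. \<beta> p \<in> U}" and q: "q \<in> {p \<in> topspace S2. \<beta> p \<in> U}" and "F p = F q"
      then have "h (\<beta> p) = h (\<beta> q)" using eq[of p] eq[of q] by simp
      then have "\<beta> p = \<beta> q" using inj_onD[OF U(3)] p q by blast
      then show "p = q" using inj_onD[OF b(2)] p q by blast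
    qed
    then show "\<exists>U. openin S2 U \<and> x \<in> U \<and> inj_on F U"
      using b(6)[OF U(1)] U(2) x by blast
  qed
  have crit: "x \<in> critical_set F \<longleftrightarrow> \<beta> x \<in> critical_set h" if "x \<in> topspace S2" for x
    unfolding critical_set_def mem_Collect_eq using that b(4)[OF that] iff[OF that]
    by (simp only: simp_thms)
  show ?thesis
  proof (intro equalityI subsetI)
    fix y assume "y \<in> \<beta> ` critical_set F"
    then show "y \<in> critical_set h" using crit critical_set_subset by blast
  next
    fix y assume y: "y \<in> critical_set h"
    then have "y \<in> \<beta> ` topspace S2" using b(3) critical_set_subset by blast
    then show "y \<in> \<beta> ` critical_set F" using crit y by blast
  qed
qed

lemma double_cover_homeo_comp:
  assumes f: "double_cover f" and \<alpha>: "homeomorphic_map S2 S2 \<alpha>"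
  shows "double_cover (\<alpha> \<circ> f)" and "critical_set (\<alpha> \<circ> f) = critical_set f"
proof -
  note a = homeo_S2D[OF \<alpha>]
  have contf: "continuous_map S2 S2 f" using f by (simp add: double_cover_def)
  obtain \<alpha>' where m: "homeomorphic_maps S2 S2 \<alpha> \<alpha>'" using \<alpha> homeomorphic_map_maps by blast
  have \<alpha>': "homeomorphic_map S2 S2 \<alpha>'" using m homeomorphic_maps_map by blast
  have inv: "\<alpha>' (\<alpha> x) = x" "\<alpha> (\<alpha>' x) = x" if "x \<in> topspace S2" for x
    using m that by (simp_all add: homeomorphic_maps_def)
  have id: "homeomorphic_map S2 S2 id" by (simp add: homeomorphic_map_id)
  have F: "(\<alpha> \<circ> f) x \<in> topspace S2" if "x \<in> topspace S2" for x
    using a(4) double_cover_in_S2[OF f that] by simp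
  \<comment> \<open>With the inverse of \<open>\<alpha>\<close> on the target and the identity on
    the source, \<open>f\<close> takes the role of \<open>h\<close> in the semiconjugacy
    lemmas.\<close>
  have eq: "\<alpha>' ((\<alpha> \<circ> f) x) = f (id x)" if "x \<in> topspace S2" for x
    using inv double_cover_in_S2[OF f that] by simp
  show crit: "critical_set (\<alpha> \<circ> f) = critical_set f"
    using critical_set_semiconjugate[where F = "\<alpha> \<circ> f" and h = f, OF \<alpha>' id F eq] by simp
  have "locally_power_map_at (\<alpha> \<circ> f) x" if x: "x \<in> topspace S2" for x
    using f x by (intro locally_power_map_at_semiconjugate[where F = "\<alpha> \<circ> f" and h = f, OF \<alpha>' id F eq x]) (auto simp: double_cover_def)
  moreover have "quadratic (\<alpha> \<circ> f)"
    unfolding quadratic_def has_degree_def crit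
  proof
    fix y assume y: "y \<in> topspace S2 - (\<alpha> \<circ> f) ` critical_set f"
    then have "\<alpha>' y \<notin> f ` critical_set f" using inv(2)[of y] by (auto simp: image_iff)
    moreover have "{x \<in> topspace S2. (\<alpha> \<circ> f) x = y} = {x \<in> topspace S2. f x = \<alpha>' y}"
      using y inv double_cover_in_S2[OF f] by fastforce
    ultimately show "card {x \<in> topspace S2. (\<alpha> \<circ> f) x = y} = 2"
      using double_cover_regular_fibre[OF f] homeo_S2D(4)[OF \<alpha>'] y by simp
  qed
  ultimately show "double_cover (\<alpha> \<circ> f)"
    using continuous_map_compose[OF contf a(1)] by (simp add: double_cover_def)
qed

section \<open>Adjusting finite sets relative to their preimages\<close>

definition preimage_S2 :: "((nat \<Rightarrow> real) \<Rightarrow> nat \<Rightarrow> real) \<Rightarrow> (nat \<Rightarrow> real) set \<Rightarrow> (nat \<Rightarrow> real) set"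
  where "preimage_S2 f A = {x \<in> topspace S2. f x \<in> A}"

text \<open>Riemann-Hurwitz count: the two critical values have one preimage each and every other
  point has two. The subtraction is exact because \<open>A\<close> contains both critical
  values.\<close>

lemma card_preimage_S2:
  assumes f: "double_cover f" and A: "finite A" "A \<subseteq> topspace S2" "f ` critical_set f \<subseteq> A"
  shows "finite (preimage_S2 f A)" and "card (preimage_S2 f A) = 2 * card A - 2"
proof -
  obtain c0 c1 where c: "critical_set f = {c0, c1}" "c0 \<noteq> c1" "f c0 \<noteq> f c1"
    "\<And>y. y \<in> topspace S2 \<Longrightarrow> y \<noteq> f c0 \<Longrightarrow> y \<noteq> f c1 \<Longrightarrow> card {x \<in> topspace S2. f x = y} = 2"
    "\<And>x. x \<in> topspace S2 \<Longrightarrow> f x = f c0 \<Longrightarrow> x = c0"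
    "\<And>x. x \<in> topspace S2 \<Longrightarrow> f x = f c1 \<Longrightarrow> x = c1"
    using double_cover_fibres[OF f] by blast
  have S: "c0 \<in> topspace S2" "c1 \<in> topspace S2" using c(1) critical_set_subset by blast+
  define \<Phi> where "\<Phi> y = {x \<in> topspace S2. f x = y}" for y
  define B where "B = A - {f c0, f c1}"
  have fib0: "\<Phi> (f c0) = {c0}" and fib1: "\<Phi> (f c1) = {c1}"
    using c(5,6) S by (auto simp: \<Phi>_def)
  have card\<Phi>: "card (\<Phi> y) = 2" if "y \<in> B" for y
    using that c(4) A(2) by (auto simp: B_def \<Phi>_def)
  then have fin\<Phi>: "finite (\<Phi> y)" if "y \<in> B" for y
    using that by (intro card_ge_0_finite) simp
  have finB: "finite B" using A by (simp add: B_def)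
  have eq: "preimage_S2 f A = (\<Union>y\<in>B. \<Phi> y) \<union> {c0, c1}"
    using A(3) c(1,5,6) S by (auto simp: preimage_S2_def B_def \<Phi>_def)
  show "finite (preimage_S2 f A)" unfolding eq using finB fin\<Phi> by blast
  have "card (\<Union>y\<in>B. \<Phi> y) = (\<Sum>y\<in>B. card (\<Phi> y))"
    using finB fin\<Phi> by (intro card_UN_disjoint) (auto simp: \<Phi>_def)
  also have "\<dots> = 2 * card B" using card\<Phi> by simp
  finally have 1: "card (\<Union>y\<in>B. \<Phi> y) = 2 * card B" .
  have "card (preimage_S2 f A) = card (\<Union>y\<in>B. \<Phi> y) + card {c0, c1}"
    unfolding eq using finB fin\<Phi> by (intro card_Un_disjoint) (auto simp: \<Phi>_def B_def)
  then have 2: "card (preimage_S2 f A) = 2 * card B + 2" using 1 c(2) by simp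
  have "card {f c0, f c1} = 2" using c(3) by simp
  moreover have "card B = card A - card {f c0, f c1}"
    unfolding B_def using A c(1) by (intro card_Diff_subset) auto
  moreover have "card {f c0, f c1} \<le> card A" using A c(1) by (intro card_mono) auto
  ultimately show "card (preimage_S2 f A) = 2 * card A - 2" using 2 by simp
qed

text \<open>The new point falls outside the new preimage if its value is neither in \<open>A\<close>
  nor itself. Old points keep their status if none of them is mapped to it.\<close>

lemma add_point_outside_preimage:
  assumes f: "double_cover f" and A: "finite A" "A \<subseteq> topspace S2"
  obtains t where "t \<in> topspace S2" "t \<notin> A"
    "insert t A \<inter> preimage_S2 f (insert t A) = A \<inter> preimage_S2 f A"
    "insert t A - preimage_S2 f (insert t A) = insert t (A - preimage_S2 f A)"
proof -
  \<comment> \<open>As \<open>f t\<close> will be \<open>y\<close>, keeping \<open>y\<close> out of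
    the three sets keeps, respectively, \<open>f t\<close> out of \<open>A\<close>, \<open>t\<close>
    out of \<open>A\<close>, and \<open>t\<close> out of the image of \<open>A\<close>.\<close>
  let ?F = "A \<union> f ` A \<union> f ` f ` A"
  \<comment> \<open>\<open>f\<close> may fix all points of an open set, so \<open>t\<close> is chosen as a point of a generic fibre other than its value.\<close>
  obtain z where "z \<in> topspace S2" using infinite_S2 by fastforce
  then obtain y where y: "y \<in> topspace S2 - ?F" "card {x \<in> topspace S2. f x = y} = 2"
    using double_cover_generic_point[OF f openin_topspace _, of z ?F] A(1) by auto
  obtain a b where ab: "{x \<in> topspace S2. f x = y} = {a, b}" "a \<noteq> b"
    using y(2)[unfolded card_2_iff] by (elim exE conjE)
  have "a \<in> {x \<in> topspace S2. f x = y}" "b \<in> {x \<in> topspace S2. f x = y}"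
    unfolding ab(1) by simp_all
  then have S: "a \<in> topspace S2" "f a = y" "b \<in> topspace S2" "f b = y" by simp_all
  define t where "t = (if a = y then b else a)"
  have t: "t \<in> topspace S2" "f t = y" "t \<noteq> y" using S ab(2) by (auto simp: t_def)
  have new: "t \<notin> A" "t \<notin> f ` A" "f t \<notin> A" using y t(2) by auto
  have "insert t A \<inter> preimage_S2 f (insert t A) = A \<inter> preimage_S2 f A"
    "insert t A - preimage_S2 f (insert t A) = insert t (A - preimage_S2 f A)"
    using new t(2,3) y by (auto simp: preimage_S2_def)
  then show ?thesis by (rule that[OF t(1) new(1)])
qed

text \<open>By the count of preimages, \<open>?M - A\<close> has \<open>card A - 2\<close> more
  points than \<open>A - ?M\<close>. Hence some point of \<open>?M - A\<close> is not a value of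
  \<open>f\<close> on \<open>A - ?M\<close>, and inserting it changes the status of no old
  point.\<close>

lemma add_point_inside_preimage:
  assumes f: "double_cover f" and A: "finite A" "A \<subseteq> topspace S2" "f ` critical_set f \<subseteq> A" "card A \<ge> 3"
  obtains t where "t \<in> topspace S2" "t \<notin> A"
    "insert t A \<inter> preimage_S2 f (insert t A) = insert t (A \<inter> preimage_S2 f A)"
    "insert t A - preimage_S2 f (insert t A) = A - preimage_S2 f A"
proof -
  let ?M = "preimage_S2 f A"
  have fin: "finite ?M" and card: "card ?M = 2 * card A - 2" using card_preimage_S2[OF f A(1-3)] by auto
  have "card (A \<inter> ?M) + card (A - ?M) = card A" using A(1) by (metis card_Int_Diff)
  moreover have "card (?M - A) = card ?M - card (A \<inter> ?M)"
    using fin A(1) by (metis Int_commute card_Diff_subset_Int finite_Int)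
  ultimately have "card (A - ?M) < card (?M - A)" using card A(4) by linarith
  moreover have "card (f ` (A - ?M)) \<le> card (A - ?M)" using A(1) by (intro card_image_le) simp
  ultimately have "\<not> ?M - A \<subseteq> f ` (A - ?M)"
    using A(1) by (meson card_mono finite_Diff finite_imageI le_trans not_le)
  then obtain t where t: "t \<in> ?M" "t \<notin> A" "t \<notin> f ` (A - ?M)" by blast
  \<comment> \<open>Points of \<open>A \<inter> ?M\<close> have values in \<open>A\<close>, which
    omits \<open>t\<close>; points of \<open>A - ?M\<close> are covered by the choice of
    \<open>t\<close>.\<close>
  have "f x \<noteq> t" if "x \<in> A" for x
    using that t A(2) by (auto simp: preimage_S2_def)
  then have "x \<in> preimage_S2 f (insert t A) \<longleftrightarrow> x \<in> ?M" if "x \<in> insert t A" for x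
    using that t by (auto simp: preimage_S2_def)
  moreover have "t \<in> topspace S2" using t by (simp add: preimage_S2_def)
  ultimately show ?thesis using that[of t] t by auto
qed

text \<open>Each kind of insertion raises one count by 1 and keeps the other, and
  \<open>card A \<ge> 3\<close> persists, so the two counts can be raised independently.\<close>

lemma enlarge_to_prescribed_cards:
  assumes f: "double_cover f"
  shows "finite A \<Longrightarrow> A \<subseteq> topspace S2 \<Longrightarrow> f ` critical_set f \<subseteq> A \<Longrightarrow> card A \<ge> 3 \<Longrightarrow>
    \<exists>B. finite B \<and> B \<subseteq> topspace S2 \<and> A \<subseteq> B \<and>
      card (B \<inter> preimage_S2 f B) = card (A \<inter> preimage_S2 f A) + m \<and>
      card (B - preimage_S2 f B) = card (A - preimage_S2 f A) + n"
proof (induction m arbitrary: A)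
  case 0
  then show ?case
  proof (induction n arbitrary: A)
    case 0
    then show ?case by (intro exI[of _ A]) simp
  next
    case (Suc n)
    obtain t where t: "t \<in> topspace S2" "t \<notin> A"
      "insert t A \<inter> preimage_S2 f (insert t A) = A \<inter> preimage_S2 f A"
      "insert t A - preimage_S2 f (insert t A) = insert t (A - preimage_S2 f A)"
      by (rule add_point_outside_preimage[OF f Suc.prems(1,2)])
    have "card A \<le> card (insert t A)" using Suc.prems(1) by (intro card_mono) auto
    then obtain B where "finite B" "B \<subseteq> topspace S2" "insert t A \<subseteq> B"
      "card (B \<inter> preimage_S2 f B) = card (insert t A \<inter> preimage_S2 f (insert t A)) + 0"
      "card (B - preimage_S2 f B) = card (insert t A - preimage_S2 f (insert t A)) + n"
      using Suc.IH[of "insert t A"] Suc.prems t(1) by auto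
    moreover have "card (insert t (A - preimage_S2 f A)) = Suc (card (A - preimage_S2 f A))"
      using Suc.prems(1) t(2) by simp
    ultimately show ?case unfolding t(3,4) by (intro exI[of _ B]) auto
  qed
next
  case (Suc m)
  obtain t where t: "t \<in> topspace S2" "t \<notin> A"
    "insert t A \<inter> preimage_S2 f (insert t A) = insert t (A \<inter> preimage_S2 f A)"
    "insert t A - preimage_S2 f (insert t A) = A - preimage_S2 f A"
    by (rule add_point_inside_preimage[OF f Suc.prems])
  have "card A \<le> card (insert t A)" using Suc.prems(1) by (intro card_mono) auto
  then obtain B where "finite B" "B \<subseteq> topspace S2" "insert t A \<subseteq> B"
    "card (B \<inter> preimage_S2 f B) = card (insert t A \<inter> preimage_S2 f (insert t A)) + m"
    "card (B - preimage_S2 f B) = card (insert t A - preimage_S2 f (insert t A)) + n"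
    using Suc.IH[of "insert t A"] Suc.prems t(1) by auto
  moreover have "card (insert t (A \<inter> preimage_S2 f A)) = Suc (card (A \<inter> preimage_S2 f A))"
    using Suc.prems(1) t(2) by simp
  ultimately show ?case unfolding t(3,4) by (intro exI[of _ B]) auto
qed

lemma bij_betw_extend:
  assumes a: "bij_betw a X Y" and fin: "finite X'" "finite Y'" "card X' = card Y'"
    and disj: "X \<inter> X' = {}" "Y \<inter> Y' = {}"
  obtains b where "\<And>x. x \<in> X \<Longrightarrow> b x = a x" "bij_betw b X' Y'" "bij_betw b (X \<union> X') (Y \<union> Y')"
proof -
  obtain s where s: "bij_betw s X' Y'" using fin finite_same_card_bij by blast
  define b where "b = (\<lambda>x. if x \<in> X then a x else s x)"
  have ba: "b x = a x" if "x \<in> X" for x using that by (simp add: b_def)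
  have "bij_betw b X Y" using a ba by (metis bij_betw_cong)
  moreover have "b x = s x" if "x \<in> X'" for x using that disj by (auto simp: b_def)
  then have "bij_betw b X' Y'" using s by (metis bij_betw_cong)
  ultimately show ?thesis using that ba bij_betw_combine disj(2) by blast
qed

text \<open>The bijection is assembled from the blocks \<open>V\<close>,
  \<open>A \<inter> M - V\<close>, \<open>A - M\<close> and \<open>M - A\<close>, whose sizes agree
  with those of their counterparts.\<close>

lemma matching_bijection:
  assumes fin: "finite A" "finite M" "finite B" "finite W"
    and V: "V \<subseteq> A \<inter> M" "V' \<subseteq> B \<inter> W" "card V = card V'"
    and card: "card (A \<inter> M) = card (B \<inter> W)" "card (A - M) = card (B - W)" "card M = card W"
  obtains a where "inj_on a (A \<union> M)" "a ` V = V'" "a ` A = B" "a ` M = W"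
proof -
  have fV: "finite V" "finite V'" using V fin finite_subset by blast+
  have c1: "card (A \<inter> M - V) = card (B \<inter> W - V')"
    using V card fV by (simp add: card_Diff_subset)
  have "card (M - A) = card M - card (A \<inter> M)" "card (W - B) = card W - card (B \<inter> W)"
    using fin by (metis Int_commute card_Diff_subset_Int finite_Int)+
  then have c3: "card (M - A) = card (W - B)" using card by simp
  obtain a0 where a0: "bij_betw a0 V V'" using fV V(3) finite_same_card_bij by blast
  obtain a1 where a1: "\<And>x. x \<in> V \<Longrightarrow> a1 x = a0 x" "bij_betw a1 (V \<union> (A \<inter> M - V)) (V' \<union> (B \<inter> W - V'))"
    by (rule bij_betw_extend[OF a0 _ _ c1]) (use fin in auto)
  have e: "V \<union> (A \<inter> M - V) = A \<inter> M" "V' \<union> (B \<inter> W - V') = B \<inter> W" using V by auto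
  obtain a2 where a2: "\<And>x. x \<in> A \<inter> M \<Longrightarrow> a2 x = a1 x" "bij_betw a2 (A \<inter> M \<union> (A - M)) (B \<inter> W \<union> (B - W))"
    by (rule bij_betw_extend[OF a1(2)[unfolded e] _ _ card(2)]) (use fin in auto)
  have e2: "A \<inter> M \<union> (A - M) = A" "B \<inter> W \<union> (B - W) = B" by auto
  obtain a3 where a3: "\<And>x. x \<in> A \<Longrightarrow> a3 x = a2 x" "bij_betw a3 (M - A) (W - B)"
    "bij_betw a3 (A \<union> (M - A)) (B \<union> (W - B))"
    by (rule bij_betw_extend[OF a2(2)[unfolded e2] _ _ c3]) (use fin in auto)
  have "a3 ` V = V'"
    using a0 a1(1) a2(1) a3(1) V(1) by (auto simp: bij_betw_def image_iff subset_iff)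
  moreover have imA: "a3 ` A = B"
    using a2(2) a3(1) e2 by (simp add: bij_betw_def)
  moreover have "a3 ` (A \<inter> M) = B \<inter> W"
    using a1(2) a2(1) a3(1) unfolding e by (auto simp: bij_betw_def image_iff)
  then have "a3 ` M = W"
  proof -
    have "a3 ` M = a3 ` (A \<inter> M) \<union> a3 ` (M - A)" by blast
    also have "\<dots> = W" using \<open>a3 ` (A \<inter> M) = B \<inter> W\<close> a3(2) by (auto simp: bij_betw_def)
    finally show ?thesis .
  qed
  moreover have "inj_on a3 (A \<union> M)" using a3(3) by (simp add: bij_betw_def Un_Diff_cancel)
  ultimately show ?thesis using that by blast
qed

section \<open>Assembling the mapping class and the conjugacy\<close>

lemma marked_quadratic_double_cover:
  "marked_branched_cover f M \<Longrightarrow> quadratic f \<Longrightarrow> double_cover f"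
  by (simp add: marked_branched_cover_def branched_cover_def double_cover_def)

lemma funpow_semiconjugate:
  assumes F: "\<And>x. x \<in> topspace S2 \<Longrightarrow> F x \<in> topspace S2"
    and eq: "\<And>x. x \<in> topspace S2 \<Longrightarrow> \<alpha> (F x) = h (\<alpha> x)" and x: "x \<in> topspace S2"
  shows "(F ^^ n) x \<in> topspace S2 \<and> \<alpha> ((F ^^ n) x) = (h ^^ n) (\<alpha> x)"
  using assms by (induction n) auto

lemma conjugate_critical_postcritical:
  assumes \<alpha>: "homeomorphic_map S2 S2 \<alpha>"
    and F: "\<And>x. x \<in> topspace S2 \<Longrightarrow> F x \<in> topspace S2"
    and eq: "\<And>x. x \<in> topspace S2 \<Longrightarrow> \<alpha> (F x) = h (\<alpha> x)"
  shows "\<alpha> ` critical_set F = critical_set h" and "\<alpha> ` postcritical_set F = postcritical_set h"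
    and "postcritical_set F \<subseteq> topspace S2"
proof -
  show crit: "\<alpha> ` critical_set F = critical_set h"
    by (rule critical_set_semiconjugate[where F = F and h = h, OF \<alpha> \<alpha> F eq])
  have fp: "(F ^^ n) x \<in> topspace S2" "\<alpha> ((F ^^ n) x) = (h ^^ n) (\<alpha> x)" if "x \<in> critical_set F" for n x
    using funpow_semiconjugate[where F = F and h = h and \<alpha> = \<alpha>, OF F eq] that critical_set_subset by blast+
  have "\<alpha> ` (F ^^ n) ` critical_set F = (h ^^ n) ` critical_set h" for n
    unfolding crit[symmetric] image_image using fp by (intro image_cong) auto
  then show "\<alpha> ` postcritical_set F = postcritical_set h"
    unfolding postcritical_set_def image_UN by simp
  show "postcritical_set F \<subseteq> topspace S2" unfolding postcritical_set_def using fp by blast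
qed

lemma marked_homeo_class:
  assumes "\<phi> \<in> marked_homeos M"
  shows "\<exists>\<Phi>\<in>Mod_S2 M. \<phi> \<in> \<Phi>"
  unfolding Mod_S2_def
  using quotientI[OF assms, of "isotopy_relation M"] equiv_class_self[OF equiv_isotopy_relation assms] by blast

lemma branched_cover_precompose_homeo:
  assumes g: "branched_cover g" and \<phi>: "orientation_preserving_homeo \<phi>"
  shows "branched_cover (g \<circ> \<phi>)"
proof -
  have h: "homeomorphic_map S2 S2 \<phi>" using \<phi> by (simp add: orientation_preserving_homeo_def)
  note p = homeo_S2D[OF h]
  have gc: "continuous_map S2 S2 g" using g by (simp add: branched_cover_def)
  have F: "(g \<circ> \<phi>) x \<in> topspace S2" if "x \<in> topspace S2" for x
    using that p(4) gc by (auto simp: continuous_map_def Pi_iff)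
  have id: "homeomorphic_map S2 S2 id" by (simp add: homeomorphic_map_id)
  have "locally_power_map_at (g \<circ> \<phi>) x" if x: "x \<in> topspace S2" for x
    by (rule locally_power_map_at_semiconjugate[where F = "g \<circ> \<phi>" and h = g, OF id h F _ x])
      (use g p(4) x in \<open>auto simp: branched_cover_def\<close>)
  moreover have "orientation_preserving (g \<circ> \<phi>)"
    using g \<phi> Brouwer_degree2_compose[OF p(1) gc]
    by (simp add: orientation_preserving_def orientation_preserving_homeo_def branched_cover_def)
  ultimately show ?thesis
    using continuous_map_compose[OF p(1) gc] by (simp add: branched_cover_def)
qed

text \<open>\<open>M\<close> and \<open>W\<close> are full preimages of sets \<open>A\<close> and
  \<open>B\<close> that \<open>\<alpha>\<close> matches. This gives the last property, by which any
  lift of \<open>\<alpha> \<circ> g\<close> through \<open>h\<close> carries \<open>M\<close> to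
  \<open>W\<close>.\<close>

lemma marked_set_matching:
  assumes g: "double_cover g" and h: "double_cover h" and Q: "finite Q" "Q \<subseteq> topspace S2"
  obtains M W \<alpha> where "finite M" "M \<subseteq> topspace S2" "Q \<subseteq> M" "orientation_preserving_homeo \<alpha>" "\<alpha> ` M = W"
    "\<alpha> ` (g ` critical_set g) = h ` critical_set h"
    "\<And>x y. x \<in> topspace S2 \<Longrightarrow> y \<in> topspace S2 \<Longrightarrow> \<alpha> (g x) = h y \<Longrightarrow> x \<in> M \<longleftrightarrow> y \<in> W"
proof -
  have start: "\<exists>A. finite A \<and> A \<subseteq> topspace S2 \<and> f ` critical_set f \<subseteq> A \<and> f ` f ` critical_set f \<subseteq> A \<and> f ` Q \<subseteq> A \<and> card A \<ge> 3"
    if f: "double_cover f" for f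
  proof -
    obtain c0 c1 where c: "critical_set f = {c0, c1}" "f c0 \<noteq> f c1" using double_cover_fibres[OF f] by metis
    \<comment> \<open>Images of critical values are included so that the critical values also lie in
      the preimage of \<open>A\<close>; images of \<open>Q\<close> put \<open>Q\<close> into that
      preimage.\<close>
    define A where "A = f ` critical_set f \<union> f ` f ` critical_set f \<union> f ` Q"
    have A: "finite A" "A \<subseteq> topspace S2"
      using c(1) Q double_cover_in_S2[OF f] critical_set_subset[of f] by (auto simp: A_def)
    \<comment> \<open>A third point provides the bound required by
      \<open>enlarge_to_prescribed_cards\<close>.\<close>
    obtain t where t: "t \<in> topspace S2" "t \<notin> A" using infinite_S2 A(1) by (meson finite_subset subsetI)
    have "card {f c0, f c1, t} = 3" using c t by (auto simp: A_def)
    moreover have "card {f c0, f c1, t} \<le> card (insert t A)"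
      using A c(1) by (intro card_mono) (auto simp: A_def)
    ultimately show ?thesis
      using A t by (intro exI[of _ "insert t A"]) (auto simp: A_def)
  qed
  obtain A0 where A0: "finite A0" "A0 \<subseteq> topspace S2" "g ` critical_set g \<subseteq> A0" "g ` g ` critical_set g \<subseteq> A0" "g ` Q \<subseteq> A0" "card A0 \<ge> 3"
    using start[OF g] by blast
  obtain B0 where B0: "finite B0" "B0 \<subseteq> topspace S2" "h ` critical_set h \<subseteq> B0" "h ` h ` critical_set h \<subseteq> B0" "card B0 \<ge> 3"
    using start[OF h] by blast
  \<comment> \<open>Each set is enlarged by the counts of the other, so both arrive at the same two
    sums.\<close>
  let ?p = "\<lambda>f A. card (A \<inter> preimage_S2 f A)" and ?q = "\<lambda>f A. card (A - preimage_S2 f A)"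
  obtain A where A: "finite A" "A \<subseteq> topspace S2" "A0 \<subseteq> A" "?p g A = ?p g A0 + ?p h B0" "?q g A = ?q g A0 + ?q h B0"
    using enlarge_to_prescribed_cards[OF g A0(1,2,3,6), of "?p h B0" "?q h B0"] by blast
  obtain B where B: "finite B" "B \<subseteq> topspace S2" "B0 \<subseteq> B" "?p h B = ?p h B0 + ?p g A0" "?q h B = ?q h B0 + ?q g A0"
    using enlarge_to_prescribed_cards[OF h B0(1,2,3,5), of "?p g A0" "?q g A0"] by blast
  define M where "M = preimage_S2 g A"
  define W where "W = preimage_S2 h B"
  have VA: "g ` critical_set g \<subseteq> A" and VB: "h ` critical_set h \<subseteq> B" using A(3) A0(3) B(3) B0(3) by blast+
  have M: "finite M" "card M = 2 * card A - 2" using card_preimage_S2[OF g A(1,2) VA] by (simp_all add: M_def)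
  have W: "finite W" "card W = 2 * card B - 2" using card_preimage_S2[OF h B(1,2) VB] by (simp_all add: W_def)
  have pq: "card (A \<inter> M) = card (B \<inter> W)" "card (A - M) = card (B - W)"
    using A(4,5) B(4,5) by (simp_all add: M_def W_def)
  then have "card A = card B" using A(1) B(1) by (metis card_Int_Diff)
  then have cardMW: "card M = card W" using M W by simp
  have VM: "g ` critical_set g \<subseteq> A \<inter> M"
  proof -
    have "g ` g ` critical_set g \<subseteq> A" using A(3) A0(4) by (rule order_trans[rotated])
    then show ?thesis using VA A(2) by (auto simp: M_def preimage_S2_def)
  qed
  have VW: "h ` critical_set h \<subseteq> B \<inter> W"
  proof -
    have "h ` h ` critical_set h \<subseteq> B" using B(3) B0(4) by (rule order_trans[rotated])
    then show ?thesis using VB B(2) by (auto simp: W_def preimage_S2_def)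
  qed
  have two: "card (f ` critical_set f) = 2" if f: "double_cover f" for f
  proof -
    obtain c0 c1 where "critical_set f = {c0, c1}" "f c0 \<noteq> f c1" using double_cover_fibres[OF f] by metis
    then show ?thesis by simp
  qed
  obtain a where a: "inj_on a (A \<union> M)" "a ` (g ` critical_set g) = h ` critical_set h" "a ` A = B" "a ` M = W"
    by (rule matching_bijection[OF A(1) M(1) B(1) W(1) VM VW _ pq cardMW]) (use two g h in auto)
  have sub: "A \<union> M \<subseteq> topspace S2" "a ` (A \<union> M) \<subseteq> topspace S2"
    using A(2) B(2) a(3,4) by (auto simp: M_def W_def preimage_S2_def)
  obtain \<alpha> where \<alpha>: "orientation_preserving_homeo \<alpha>" "\<And>p. p \<in> A \<union> M \<Longrightarrow> \<alpha> p = a p"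
    using orientation_preserving_homeo_moving_points[OF _ sub(1) a(1) sub(2)] A(1) M(1) by auto
  have im: "\<alpha> ` X = a ` X" if "X \<subseteq> A \<union> M" for X using \<alpha>(2) that by (intro image_cong) auto
  have \<alpha>A: "\<alpha> ` A = B" and \<alpha>M: "\<alpha> ` M = W" using im[of A] im[of M] a(3,4) by simp_all
  have \<alpha>V: "\<alpha> ` (g ` critical_set g) = h ` critical_set h"
    by (rule trans[OF im a(2)]) (use VA in blast)
  have inj: "inj_on \<alpha> (topspace S2)"
    using \<alpha>(1) homeo_S2D(2) by (simp add: orientation_preserving_homeo_def)
  have "x \<in> M \<longleftrightarrow> y \<in> W" if xy: "x \<in> topspace S2" "y \<in> topspace S2" "\<alpha> (g x) = h y" for x y
  proof -
    have "g x \<in> topspace S2" using double_cover_in_S2[OF g xy(1)] .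
    then have "g x \<in> A \<longleftrightarrow> \<alpha> (g x) \<in> \<alpha> ` A" using inj_on_image_mem_iff[OF inj _ A(2)] by simp
    then show ?thesis using xy \<alpha>A by (simp add: M_def W_def preimage_S2_def)
  qed
  moreover have "Q \<subseteq> M" using Q(2) A0(5) A(3) by (auto simp: M_def preimage_S2_def)
  moreover have "M \<subseteq> topspace S2" using sub by blast
  ultimately show ?thesis using that[of M \<alpha> W] M(1) \<alpha>(1) \<alpha>M \<alpha>V by blast
qed

theorem theorem1p1:
  fixes g h :: "(nat \<Rightarrow> real) \<Rightarrow> nat \<Rightarrow> real"
    and Mg Mh :: "(nat \<Rightarrow> real) set"
  assumes "marked_branched_cover g Mg" and "quadratic g"
    and "marked_branched_cover h Mh" and "quadratic h"
  shows "\<exists>M. finite M \<and> M \<subseteq> topspace S2 \<and>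
           postcritical_set g \<subseteq> M \<and> postcritical_set h \<subseteq> M \<and>
           (\<exists>\<Phi> \<in> Mod_S2 M. \<exists>\<phi> \<in> \<Phi>. pure_Hurwitz_equivalent (g \<circ> \<phi>) h)"
proof -
  have bg: "branched_cover g" and bh: "branched_cover h"
    using assms(1,3) by (simp_all add: marked_branched_cover_def)
  have g: "double_cover g" and h: "double_cover h"
    using assms marked_quadratic_double_cover by blast+
  have P: "finite (postcritical_set g \<union> postcritical_set h)" "postcritical_set g \<union> postcritical_set h \<subseteq> topspace S2"
    using assms(1,3) by (auto simp: marked_branched_cover_def intro: finite_subset)
  obtain M W \<alpha> where M: "finite M" "M \<subseteq> topspace S2" "postcritical_set g \<union> postcritical_set h \<subseteq> M"
    and \<alpha>: "orientation_preserving_homeo \<alpha>" "\<alpha> ` M = W" "\<alpha> ` (g ` critical_set g) = h ` critical_set h"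
    and MW: "\<And>x y. x \<in> topspace S2 \<Longrightarrow> y \<in> topspace S2 \<Longrightarrow> \<alpha> (g x) = h y \<Longrightarrow> x \<in> M \<longleftrightarrow> y \<in> W"
    using marked_set_matching[OF g h P] by metis
  have \<alpha>h: "homeomorphic_map S2 S2 \<alpha>" using \<alpha>(1) by (simp add: orientation_preserving_homeo_def)
  note a = homeo_S2D[OF \<alpha>h] and ag = double_cover_homeo_comp[OF g \<alpha>h]
  \<comment> \<open>Postcomposition with \<open>\<alpha>\<close> leaves the critical points in place
    and moves the critical values onto those of \<open>h\<close>, as \<open>lift_to_homeo\<close>
    requires.\<close>
  have "(\<alpha> \<circ> g) ` critical_set (\<alpha> \<circ> g) = h ` critical_set h"
    using \<alpha>(3) ag(2) by (simp add: image_image)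
  then obtain \<beta> where \<beta>: "homeomorphic_map S2 S2 \<beta>" "\<And>x. x \<in> topspace S2 \<Longrightarrow> h (\<beta> x) = \<alpha> (g x)"
    using lift_to_homeo[OF ag(1) h] by (metis comp_apply)
  note b = homeo_S2D[OF \<beta>(1)]
  obtain \<beta>' where m: "homeomorphic_maps S2 S2 \<beta> \<beta>'" using \<beta>(1) homeomorphic_map_maps by blast
  have \<beta>'h: "homeomorphic_map S2 S2 \<beta>'" using m homeomorphic_maps_map by blast
  have inv: "\<beta>' (\<beta> x) = x" "\<beta> (\<beta>' x) = x" if "x \<in> topspace S2" for x
    using m that by (simp_all add: homeomorphic_maps_def)
  note b' = homeo_S2D[OF \<beta>'h]
  have cont: "continuous_map S2 S2 g" "continuous_map S2 S2 h"
    using bg bh by (simp_all add: branched_cover_def)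
  have deg: "Brouwer_degree2 2 g > 0" "Brouwer_degree2 2 h > 0" "Brouwer_degree2 2 \<alpha> > 0"
    using bg bh \<alpha>(1) by (simp_all add: branched_cover_def orientation_preserving_homeo_def orientation_preserving_def)
  \<comment> \<open>The lift comes without orientation; multiplicativity of the degree in
    \<open>h \<circ> \<beta> = \<alpha> \<circ> g\<close> shows that its degree is positive.\<close>
  have "Brouwer_degree2 2 (h \<circ> \<beta>) = Brouwer_degree2 2 (\<alpha> \<circ> g)"
    by (rule Brouwer_degree2_eq) (simp add: \<beta>(2))
  then have "Brouwer_degree2 2 h * Brouwer_degree2 2 \<beta> = Brouwer_degree2 2 \<alpha> * Brouwer_degree2 2 g"
    using Brouwer_degree2_compose[OF b(1) cont(2)] Brouwer_degree2_compose[OF cont(1) a(1)] by simp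
  moreover have "0 < Brouwer_degree2 2 \<alpha> * Brouwer_degree2 2 g" using deg by simp
  ultimately have deg\<beta>: "Brouwer_degree2 2 \<beta> > 0" using deg(2) by (metis zero_less_mult_pos)
  have "Brouwer_degree2 2 (\<beta>' \<circ> \<beta>) = Brouwer_degree2 2 id"
    by (rule Brouwer_degree2_eq) (simp add: inv)
  then have "Brouwer_degree2 2 \<beta>' * Brouwer_degree2 2 \<beta> = 1"
    using Brouwer_degree2_compose[OF b(1) b'(1)] by simp
  then have deg\<beta>': "Brouwer_degree2 2 \<beta>' > 0"
    using deg\<beta> by (metis zero_less_mult_pos2 zero_less_one)
  \<comment> \<open>With this choice \<open>\<beta> \<circ> \<phi> = \<alpha>\<close> on the sphere,
    whence \<open>\<alpha> \<circ> g \<circ> \<phi> = h \<circ> \<beta> \<circ> \<phi> = h \<circ>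
    \<alpha>\<close>.\<close>
  define \<phi> where "\<phi> = \<beta>' \<circ> \<alpha>"
  have \<phi>o: "orientation_preserving_homeo \<phi>"
    unfolding orientation_preserving_homeo_def orientation_preserving_def \<phi>_def
    using homeomorphic_map_compose[OF \<alpha>h \<beta>'h] Brouwer_degree2_compose[OF a(1) b'(1)] deg(3) deg\<beta>' by simp
  \<comment> \<open>\<open>MW\<close> applies to \<open>x\<close> and \<open>\<beta> x\<close>
    because \<open>h (\<beta> x) = \<alpha> (g x)\<close>; surjectivity of \<open>\<beta>\<close>
    gives the other inclusion.\<close>
  have \<beta>M: "\<beta> ` M = W"
  proof (intro equalityI subsetI)
    fix y assume "y \<in> \<beta> ` M"
    then show "y \<in> W" using MW b(4) \<beta>(2) M(2) by (metis imageE subsetD)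
  next
    fix y assume y: "y \<in> W"
    then have yS: "y \<in> topspace S2" using \<alpha>(2) M(2) a(4) by blast
    have "\<alpha> (g (\<beta>' y)) = h y" using \<beta>(2)[OF b'(4)[OF yS]] inv(2)[OF yS] by simp
    then have "\<beta>' y \<in> M" using MW[OF b'(4)[OF yS] yS] y by blast
    then show "y \<in> \<beta> ` M" using inv(2)[OF yS] by force
  qed
  have "\<phi> ` M = \<beta>' ` \<beta> ` M" unfolding \<phi>_def image_comp[symmetric] \<alpha>(2) \<beta>M ..
  also have "\<dots> = M" using inv(1) M(2) by (force simp: image_image)
  finally have "\<phi> \<in> marked_homeos M" using \<phi>o by (simp add: marked_homeos_def)
  then obtain \<Phi> where \<Phi>: "\<Phi> \<in> Mod_S2 M" "\<phi> \<in> \<Phi>" using marked_homeo_class by blast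
  have F: "(g \<circ> \<phi>) x \<in> topspace S2" if "x \<in> topspace S2" for x
    using that double_cover_in_S2[OF g] a(4) b'(4) by (simp add: \<phi>_def)
  have eq: "\<alpha> ((g \<circ> \<phi>) x) = h (\<alpha> x)" if "x \<in> topspace S2" for x
    using that \<beta>(2)[of "\<phi> x"] a(4) b'(4) inv(2) by (simp add: \<phi>_def)
  note conj = conjugate_critical_postcritical[where F = "g \<circ> \<phi>" and h = h, OF \<alpha>h F eq]
  have finh: "finite (postcritical_set h)" using P(1) by simp
  have "finite (\<alpha> ` postcritical_set (g \<circ> \<phi>))" using conj(2) finh by (rule ssubst)
  moreover have "inj_on \<alpha> (postcritical_set (g \<circ> \<phi>))" using a(2) conj(3) by (rule inj_on_subset)
  ultimately have fin: "finite (postcritical_set (g \<circ> \<phi>))" by (rule finite_imageD)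
  have im: "\<alpha> ` (critical_set (g \<circ> \<phi>) \<union> postcritical_set (g \<circ> \<phi>)) = critical_set h \<union> postcritical_set h"
    by (simp only: image_Un conj(1,2))
  \<comment> \<open>Both homeomorphisms of the equivalence are taken to be \<open>\<alpha>\<close>,
    so their agreement on the post-critical set is immediate.\<close>
  have "pure_Hurwitz_equivalent (g \<circ> \<phi>) h"
    unfolding pure_Hurwitz_equivalent_def postcritically_finite_def
    by (intro conjI exI[of _ \<alpha>] branched_cover_precompose_homeo[OF bg \<phi>o] fin bh finh \<alpha>(1) ballI eq im refl)
  then show ?thesis using M \<Phi> by blast
qed

end
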